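(* (Low-temperature expansion on a surface with boundary.) For every relative homology class $\epsilon\in H_1(\Sigma,\partial\Sigma;\mathbb Z/2\mathbb Z)$, $$Z^\epsilon_{\mathrm{Ising}}(G^*_\Sigma,J)=2\Bigl(\prod_{e\in E_\Sigma}e^{J_{e^*}}\Bigr)\sum_{P\in\mathcal P^\epsilon(G_\Sigma)}\ \prod_{e\in P}e^{-2J_{e^*}} .$$
   Context: Let $G=(V,E)$ be a finite graph cellularly embedded in a compact, connected, orientable, boundaryless surface of genus $g\ge0$, with dual graph $G^*=(V^*,E^* )$ (dual vertices in the interior of faces). Let $p\ge0$ and let $B_0,\dots,B_{p-1}$ be pairwise disjoint unions of closed faces of $G$, each homeomorphic to a disc. $\Sigma$ is the surface with the interiors of the $B_i$ removed: a compact orientable surface of genus $g$ with boundary $\partial\Sigma=\partial B_0\cup\dots\cup\partial B_{p-1}$ (empty if $p=0$). $G_\Sigma=(V_\Sigma,E_\Sigma)$: $V_\Sigma=V\cap\Sigma$, and $E_\Sigma$ is the set of edges of $G$ contained in $\Sigma$ and not on $\partial\Sigma$. $G_\Sigma^*=(V_\Sigma^*,E_\Sigma^* )$: $V_\Sigma^*=V^*\cap\Sigma$, and $E_\Sigma^*$ is the set of dual edges $e^*$ of edges $e\in E_\Sigma$ (they join vertices of $V^*_\Sigma$). Positive coupling constants $(J_{e^*})_{e^*\in E^*}$ are given. Ising model with defect: let $\underline\epsilon\subset E_\Sigma$ be a fixed representative of $\epsilon$, namely the mod 2 union of some of fixed paths $\underline\gamma_1,\dots,\underline\gamma_N$ of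 $G_\Sigma$ whose classes form a basis of $H_1(\Sigma,\partial\Sigma;\mathbb Z/2\mathbb Z)$ (for each handle two transverse cycles around it, and for $1\le i\le p-1$ a path joining $\partial B_0$ to $\partial B_i$). Then $$Z^\epsilon_{\mathrm{Ising}}(G_\Sigma^*,J)=\sum_{\sigma\in\{-1,1\}^{V_\Sigma^*}}\exp\Bigl(\sum_{e^*=u^*v^*\in E_\Sigma^*}s_\epsilon(e)J_{e^*}\sigma_{u^*}\sigma_{v^*}\Bigr),$$ with $s_\epsilon(e)=-1$ if $e\in\underline\epsilon$ and $1$ otherwise. A polygon configuration of $G_\Sigma$ is a subset of $E_\Sigma$ such that every vertex not on $\partial\Sigma$ is incident to an even number of its edges (no condition at vertices of $\partial\Sigma$). $\mathcal P^\epsilon(G_\Sigma)$ is the set of polygon configurations whose class in $H_1(\Sigma,\partial\Sigma;\mathbb Z/2\mathbb Z)$ is $\epsilon$. *)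

theory Defs
  imports "HOL-Analysis.Analysis"
begin

section \<open>Graphs cellularly embedded in closed surfaces\<close>

definition closed_surface :: "'a topology \<Rightarrow> bool" where
  "closed_surface S \<longleftrightarrow>
     topspace S \<noteq> {} \<and> compact_space S \<and> connected_space S \<and> Hausdorff_space S \<and>
     (\<forall>x\<in>topspace S. \<exists>U (W :: complex set).
        openin S U \<and> x \<in> U \<and> open W \<and>
        subtopology S U homeomorphic_space top_of_set W)"

text \<open>
  An edge \<open>e\<close> is a path parametrised by \<open>[0,1]\<close>; \<open>(e, True)\<close> and \<open>(e, False)\<close> are its two
  directed versions.  A face \<open>f\<close> comes with a map \<open>fmap G f\<close> of the closed unit disc into the
  surface and with the cyclic sequence \<open>fwalk G f\<close> of directed edges met by its boundary.
  Loops and multiple edges are allowed, and an edge may have the same face on both sides.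
\<close>

record ('a, 'e, 'f) embedded_graph =
  surf :: "'a topology"
  verts :: "'a set"
  edges :: "'e set"
  epath :: "'e \<Rightarrow> real \<Rightarrow> 'a"
  faces :: "'f set"
  fmap :: "'f \<Rightarrow> complex \<Rightarrow> 'a"
  fwalk :: "'f \<Rightarrow> ('e \<times> bool) list"

definition dpath :: "('a, 'e, 'f) embedded_graph \<Rightarrow> 'e \<times> bool \<Rightarrow> real \<Rightarrow> 'a" where
  "dpath G d t = epath G (fst d) (if snd d then t else 1 - t)"

definition closed_edge :: "('a, 'e, 'f) embedded_graph \<Rightarrow> 'e \<Rightarrow> 'a set" where
  "closed_edge G e = epath G e ` {0..1}"

definition open_edge :: "('a, 'e, 'f) embedded_graph \<Rightarrow> 'e \<Rightarrow> 'a set" where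
  "open_edge G e = epath G e ` {0<..<1}"

definition closed_face :: "('a, 'e, 'f) embedded_graph \<Rightarrow> 'f \<Rightarrow> 'a set" where
  "closed_face G f = fmap G f ` cball 0 1"

definition open_face :: "('a, 'e, 'f) embedded_graph \<Rightarrow> 'f \<Rightarrow> 'a set" where
  "open_face G f = fmap G f ` ball 0 1"

definition skeleton :: "('a, 'e, 'f) embedded_graph \<Rightarrow> 'a set" where
  "skeleton G = verts G \<union> (\<Union>e\<in>edges G. closed_edge G e)"

definition graph_in_surface :: "('a, 'e, 'f) embedded_graph \<Rightarrow> bool" where
  "graph_in_surface G \<longleftrightarrow>
     finite (verts G) \<and> finite (edges G) \<and> verts G \<subseteq> topspace (surf G) \<and>
     (\<forall>e\<in>edges G.
        continuous_map (top_of_set {0..1}) (surf G) (epath G e) \<and>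
        epath G e 0 \<in> verts G \<and> epath G e 1 \<in> verts G \<and>
        inj_on (epath G e) {0<..<1} \<and> open_edge G e \<inter> verts G = {}) \<and>
     (\<forall>e\<in>edges G. \<forall>e'\<in>edges G. e \<noteq> e' \<longrightarrow> open_edge G e \<inter> open_edge G e' = {})"

text \<open>
  The faces are the components of the complement of the graph.  Each is an open disc, with a
  characteristic map defined on the closed disc: the unit circle is cut into as many equal arcs
  as the boundary walk has steps, and the \<open>k\<close>-th arc runs along the \<open>k\<close>-th directed edge of the
  walk.  The walk is empty only for a graph without edges (one vertex on the sphere).
\<close>

definition cellular_faces :: "('a, 'e, 'f) embedded_graph \<Rightarrow> bool" where
  "cellular_faces G \<longleftrightarrow>
     finite (faces G) \<and>
     bij_betw (open_face G) (faces G)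
       (connected_components_of (subtopology (surf G) (topspace (surf G) - skeleton G))) \<and>
     (\<forall>f\<in>faces G.
        continuous_map (top_of_set (cball 0 1)) (surf G) (fmap G f) \<and>
        homeomorphic_map (top_of_set (ball 0 1)) (subtopology (surf G) (open_face G f)) (fmap G f) \<and>
        set (fwalk G f) \<subseteq> edges G \<times> UNIV \<and>
        (fwalk G f = [] \<longrightarrow> (\<exists>v\<in>verts G. \<forall>z\<in>sphere 0 1. fmap G f z = v)) \<and>
        (\<forall>k < length (fwalk G f). \<forall>t\<in>{0..1}.
           fmap G f (cis (2 * pi * (real k + t) / real (length (fwalk G f))))
             = dpath G (fwalk G f ! k) t))"

text \<open>
  Orientability: the characteristic maps of the faces can be chosen coherently oriented, that is,
  such that every edge is traversed by the face boundaries exactly once in each direction.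
  The face whose boundary traverses a directed edge is the one lying on its left.
\<close>

definition coherently_oriented :: "('a, 'e, 'f) embedded_graph \<Rightarrow> bool" where
  "coherently_oriented G \<longleftrightarrow>
     (\<forall>d \<in> edges G \<times> UNIV. \<exists>!(f, k). f \<in> faces G \<and> k < length (fwalk G f) \<and> fwalk G f ! k = d)"

definition cellular_embedding :: "('a, 'e, 'f) embedded_graph \<Rightarrow> bool" where
  "cellular_embedding G \<longleftrightarrow>
     closed_surface (surf G) \<and> graph_in_surface G \<and> cellular_faces G \<and> coherently_oriented G"

definition has_genus :: "('a, 'e, 'f) embedded_graph \<Rightarrow> nat \<Rightarrow> bool" where
  "has_genus G g \<longleftrightarrow>
     int (card (verts G)) - int (card (edges G)) + int (card (faces G)) = 2 - 2 * int g"

text \<open>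
  The dual graph has one vertex in each face (the image of the centre of the disc); the dual of
  an edge joins the dual vertices of the faces on its two sides.
\<close>

definition dual_vertex :: "('a, 'e, 'f) embedded_graph \<Rightarrow> 'f \<Rightarrow> 'a" where
  "dual_vertex G f = fmap G f 0"

definition left_face :: "('a, 'e, 'f) embedded_graph \<Rightarrow> 'e \<times> bool \<Rightarrow> 'f" where
  "left_face G d = (THE f. f \<in> faces G \<and> d \<in> set (fwalk G f))"

definition dual_end1 :: "('a, 'e, 'f) embedded_graph \<Rightarrow> 'e \<Rightarrow> 'a" where
  "dual_end1 G e = dual_vertex G (left_face G (e, True))"

definition dual_end2 :: "('a, 'e, 'f) embedded_graph \<Rightarrow> 'e \<Rightarrow> 'a" where
  "dual_end2 G e = dual_vertex G (left_face G (e, False))"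


section \<open>The surface with boundary obtained by removing discs\<close>

definition disjoint_discs :: "('a, 'e, 'f) embedded_graph \<Rightarrow> nat \<Rightarrow> (nat \<Rightarrow> 'a set) \<Rightarrow> bool" where
  "disjoint_discs G p B \<longleftrightarrow>
     disjoint_family_on B {..<p} \<and>
     (\<forall>i<p. (\<exists>A\<subseteq>faces G. B i = (\<Union>f\<in>A. closed_face G f)) \<and>
        subtopology (surf G) (B i) homeomorphic_space top_of_set (cball (0::complex) 1))"

definition Sig :: "('a, 'e, 'f) embedded_graph \<Rightarrow> nat \<Rightarrow> (nat \<Rightarrow> 'a set) \<Rightarrow> 'a set" where
  "Sig G p B = topspace (surf G) - (\<Union>i<p. surf G interior_of B i)"

definition bd_Sig :: "('a, 'e, 'f) embedded_graph \<Rightarrow> nat \<Rightarrow> (nat \<Rightarrow> 'a set) \<Rightarrow> 'a set" where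
  "bd_Sig G p B = (\<Union>i<p. surf G frontier_of B i)"

definition V_Sig :: "('a, 'e, 'f) embedded_graph \<Rightarrow> nat \<Rightarrow> (nat \<Rightarrow> 'a set) \<Rightarrow> 'a set" where
  "V_Sig G p B = verts G \<inter> Sig G p B"

definition E_Sig :: "('a, 'e, 'f) embedded_graph \<Rightarrow> nat \<Rightarrow> (nat \<Rightarrow> 'a set) \<Rightarrow> 'e set" where
  "E_Sig G p B =
     {e \<in> edges G. closed_edge G e \<subseteq> Sig G p B \<and> \<not> closed_edge G e \<subseteq> bd_Sig G p B}"

definition F_Sig :: "('a, 'e, 'f) embedded_graph \<Rightarrow> nat \<Rightarrow> (nat \<Rightarrow> 'a set) \<Rightarrow> 'f set" where
  "F_Sig G p B = {f \<in> faces G. closed_face G f \<subseteq> Sig G p B}"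

definition dual_V_Sig :: "('a, 'e, 'f) embedded_graph \<Rightarrow> nat \<Rightarrow> (nat \<Rightarrow> 'a set) \<Rightarrow> 'a set" where
  "dual_V_Sig G p B = dual_vertex G ` faces G \<inter> Sig G p B"


section \<open>Relative homology modulo 2\<close>

text \<open>
  \<open>H\<^sub>1(\<Sigma>, \<partial>\<Sigma>; \<int>/2)\<close> is the homology of the relative cellular chain complex: the group of
  relative \<open>k\<close>-chains has as basis the \<open>k\<close>-cells of \<open>\<Sigma>\<close> not contained in \<open>\<partial>\<Sigma>\<close>, and a chain
  modulo 2 is identified with a set of cells, addition being symmetric difference.
  A loop counts twice in the degree of its vertex, and an edge having the same face on both
  sides occurs twice in the boundary walk of that face.
\<close>

definition degree_in :: "('a, 'e, 'f) embedded_graph \<Rightarrow> 'e set \<Rightarrow> 'a \<Rightarrow> nat" where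
  "degree_in G P v = card {e \<in> P. epath G e 0 = v} + card {e \<in> P. epath G e 1 = v}"

definition rel_boundary1 ::
  "('a, 'e, 'f) embedded_graph \<Rightarrow> nat \<Rightarrow> (nat \<Rightarrow> 'a set) \<Rightarrow> 'e set \<Rightarrow> 'a set" where
  "rel_boundary1 G p B P = {v \<in> V_Sig G p B - bd_Sig G p B. odd (degree_in G P v)}"

definition rel_boundary2 ::
  "('a, 'e, 'f) embedded_graph \<Rightarrow> nat \<Rightarrow> (nat \<Rightarrow> 'a set) \<Rightarrow> 'f set \<Rightarrow> 'e set" where
  "rel_boundary2 G p B X =
     {e \<in> E_Sig G p B. odd (\<Sum>f\<in>X. count_list (map fst (fwalk G f)) e)}"

text \<open>The relative 1-cycles are exactly the polygon configurations.\<close>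

definition polygon_configs ::
  "('a, 'e, 'f) embedded_graph \<Rightarrow> nat \<Rightarrow> (nat \<Rightarrow> 'a set) \<Rightarrow> 'e set set" where
  "polygon_configs G p B = {P. P \<subseteq> E_Sig G p B \<and> rel_boundary1 G p B P = {}}"

definition homologous ::
  "('a, 'e, 'f) embedded_graph \<Rightarrow> nat \<Rightarrow> (nat \<Rightarrow> 'a set) \<Rightarrow> ('e set \<times> 'e set) set" where
  "homologous G p B =
     {(P, Q). P \<in> polygon_configs G p B \<and> Q \<in> polygon_configs G p B \<and>
        (P - Q) \<union> (Q - P) \<in> rel_boundary2 G p B ` Pow (F_Sig G p B)}"

definition rel_H1 ::
  "('a, 'e, 'f) embedded_graph \<Rightarrow> nat \<Rightarrow> (nat \<Rightarrow> 'a set) \<Rightarrow> 'e set set set" where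
  "rel_H1 G p B = polygon_configs G p B // homologous G p B"

definition H1_class ::
  "('a, 'e, 'f) embedded_graph \<Rightarrow> nat \<Rightarrow> (nat \<Rightarrow> 'a set) \<Rightarrow> 'e set \<Rightarrow> 'e set set" where
  "H1_class G p B P = homologous G p B `` {P}"

definition polygon_configs_in_class ::
  "('a, 'e, 'f) embedded_graph \<Rightarrow> nat \<Rightarrow> (nat \<Rightarrow> 'a set) \<Rightarrow> 'e set set \<Rightarrow> 'e set set" where
  "polygon_configs_in_class G p B c =
     {P \<in> polygon_configs G p B. H1_class G p B P = c}"


section \<open>Paths representing a basis of the homology\<close>

text \<open>
  A path may also run along \<open>\<partial>\<Sigma>\<close>; only its edges in \<open>E\<^sub>\<Sigma>\<close> contribute to the relative chain.
  (In some graphs there are no paths joining two boundary components through \<open>E\<^sub>\<Sigma>\<close> alone.)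
\<close>

definition path_in_Sig ::
  "('a, 'e, 'f) embedded_graph \<Rightarrow> nat \<Rightarrow> (nat \<Rightarrow> 'a set) \<Rightarrow> ('e \<times> bool) list \<Rightarrow> bool" where
  "path_in_Sig G p B w \<longleftrightarrow>
     w \<noteq> [] \<and> (\<forall>d\<in>set w. fst d \<in> edges G \<and> closed_edge G (fst d) \<subseteq> Sig G p B) \<and>
     (\<forall>k. Suc k < length w \<longrightarrow> dpath G (w ! k) 1 = dpath G (w ! Suc k) 0)"

definition path_chain ::
  "('a, 'e, 'f) embedded_graph \<Rightarrow> nat \<Rightarrow> (nat \<Rightarrow> 'a set) \<Rightarrow> ('e \<times> bool) list \<Rightarrow> 'e set" where
  "path_chain G p B w = {e \<in> E_Sig G p B. odd (count_list (map fst w) e)}"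

definition mod2_union :: "(nat \<Rightarrow> 'e set) \<Rightarrow> nat set \<Rightarrow> 'e set" where
  "mod2_union C I = {e. odd (card {j \<in> I. e \<in> C j})}"

text \<open>
  The paths \<open>\<gamma> 0, ..., \<gamma> (2 g - 1)\<close> are closed, and \<open>\<gamma> (2 g + i - 1)\<close> joins \<open>\<partial>B\<^sub>0\<close> to \<open>\<partial>B\<^sub>i\<close>
  for \<open>1 \<le> i < p\<close>.  Being a basis over \<open>\<int>/2\<close> means that every class is a sum of a unique
  subfamily; the truncated \<open>p - 1\<close> vanishes for \<open>p = 0\<close> as it should.
\<close>

definition homology_basis_paths ::
  "('a, 'e, 'f) embedded_graph \<Rightarrow> nat \<Rightarrow> nat \<Rightarrow> (nat \<Rightarrow> 'a set) \<Rightarrow>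
     (nat \<Rightarrow> ('e \<times> bool) list) \<Rightarrow> bool" where
  "homology_basis_paths G g p B \<gamma> \<longleftrightarrow>
     (\<forall>j < 2 * g + (p - 1). path_in_Sig G p B (\<gamma> j)) \<and>
     (\<forall>j < 2 * g. dpath G (last (\<gamma> j)) 1 = dpath G (hd (\<gamma> j)) 0) \<and>
     (\<forall>i. 1 \<le> i \<and> i < p \<longrightarrow>
        dpath G (hd (\<gamma> (2 * g + i - 1))) 0 \<in> surf G frontier_of B 0 \<and>
        dpath G (last (\<gamma> (2 * g + i - 1))) 1 \<in> surf G frontier_of B i) \<and>
     (\<forall>c \<in> rel_H1 G p B. \<exists>!I. I \<subseteq> {..< 2 * g + (p - 1)} \<and>
        H1_class G p B (mod2_union (\<lambda>j. path_chain G p B (\<gamma> j)) I) = c)"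

definition class_representative ::
  "('a, 'e, 'f) embedded_graph \<Rightarrow> nat \<Rightarrow> nat \<Rightarrow> (nat \<Rightarrow> 'a set) \<Rightarrow>
     (nat \<Rightarrow> ('e \<times> bool) list) \<Rightarrow> 'e set set \<Rightarrow> 'e set" where
  "class_representative G g p B \<gamma> c =
     mod2_union (\<lambda>j. path_chain G p B (\<gamma> j))
       (THE I. I \<subseteq> {..< 2 * g + (p - 1)} \<and>
          H1_class G p B (mod2_union (\<lambda>j. path_chain G p B (\<gamma> j)) I) = c)"


section \<open>The Ising model on the dual graph\<close>

definition defect_sign :: "'e set \<Rightarrow> 'e \<Rightarrow> real" where
  "defect_sign D e = (if e \<in> D then -1 else 1)"

text \<open>The coupling constant \<open>J e\<close> is the one attached to the dual edge of \<open>e\<close>.\<close>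

definition Z_Ising ::
  "('a, 'e, 'f) embedded_graph \<Rightarrow> nat \<Rightarrow> (nat \<Rightarrow> 'a set) \<Rightarrow> ('e \<Rightarrow> real) \<Rightarrow> 'e set \<Rightarrow> real" where
  "Z_Ising G p B J D =
     (\<Sum>\<sigma> \<in> dual_V_Sig G p B \<rightarrow>\<^sub>E {-1, 1 :: real}.
        exp (\<Sum>e\<in>E_Sig G p B.
               defect_sign D e * J e * \<sigma> (dual_end1 G e) * \<sigma> (dual_end2 G e)))"

end

theory Submission
  imports Defs
begin

text \<open>
  Every edge \<open>e\<close> of \<open>E_Sig\<close> carries the factor \<open>exp (\<plusminus> J e)\<close>, and the sign is negative exactly when
  \<open>e\<close> lies in the mod 2 sum \<open>P\<close> of the defect \<open>D\<close> and the set of edges separating opposite spins.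
  If \<open>X\<close> is the set of faces with spin \<open>-1\<close>, these separating edges form the relative boundary of
  \<open>X\<close>.  Hence \<open>P = D + \<partial>X\<close>: as \<open>X\<close> runs over all sets of faces of \<open>\<Sigma>\<close>, the set \<open>P\<close> runs over the
  polygon configurations homologous to \<open>D\<close>, and since \<open>D\<close> represents \<open>\<epsilon>\<close> these are the configurations
  of class \<open>\<epsilon>\<close>.  What remains is to see that each \<open>P\<close> is reached from exactly two sets \<open>X\<close>, that is,
  that \<open>\<partial>\<close> has the kernel \<open>{\<emptyset>, F_Sig}\<close> and that \<open>F_Sig\<close> is not empty.

  This last point is where topology enters; it says that the dual graph of \<open>\<Sigma>\<close> is nonempty and
  connected.  First, the dual graph of the whole closed surface is connected, because a closed
  surface stays connected when finitely many points are deleted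
  (\<open>dual_graph_connected\<close>).  Now let \<open>X\<close> be a set of faces of \<open>\<Sigma>\<close> with \<open>\<partial>X = 0\<close> relative to
  \<open>\<partial>\<Sigma>\<close>.  The absolute boundary of \<open>X\<close> is an even graph all of whose edges lie on the frontiers of
  the discs.  By invariance of domain such a frontier lies on a circle, and an even graph drawn on
  a circle is all or nothing: if it missed a point of the circle, it could be drawn on a line, and
  its topmost point would be a vertex of degree one (\<open>even_subgraph_of_disc_boundary\<close>).  Therefore the
  boundary of \<open>X\<close> is the sum of the boundaries of some of the discs.  Adding the faces of these
  discs to \<open>X\<close> gives a set of faces of the closed surface without boundary, which is empty or
  everything (\<open>rel_boundary2_kernel\<close>).  Finally, if \<open>\<Sigma>\<close> had no faces, one of the disjoint discs
  would be the whole closed surface, against invariance of domain (\<open>F_Sig_nonempty\<close>).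
\<close>

section \<open>Topology of closed surfaces\<close>

lemma surface_chart:
  assumes "closed_surface S" "x \<in> topspace S"
  obtains U and W :: "complex set" and \<phi> \<psi> where
    "openin S U" "x \<in> U" "open W"
    "homeomorphic_maps (subtopology S U) (top_of_set W) \<phi> \<psi>"
  using assms unfolding closed_surface_def homeomorphic_space_def by meson

lemma homeomorphic_maps_chartD:
  assumes "openin S U" "homeomorphic_maps (subtopology S U) (top_of_set W) \<phi> \<psi>"
  shows "continuous_map (subtopology S U) (top_of_set W) \<phi>"
    "continuous_map (top_of_set W) S \<psi>"
    "\<And>x. x \<in> U \<Longrightarrow> \<phi> x \<in> W \<and> \<psi> (\<phi> x) = x"
    "\<And>w. w \<in> W \<Longrightarrow> \<psi> w \<in> U \<and> \<phi> (\<psi> w) = w"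
    "\<And>T. openin (top_of_set W) T \<Longrightarrow> openin S (\<psi> ` T)"
proof -
  have U: "topspace (subtopology S U) = U"
    using assms(1) openin_subset by fastforce
  show "continuous_map (subtopology S U) (top_of_set W) \<phi>"
    using assms(2) by (simp add: homeomorphic_maps_def)
  show "continuous_map (top_of_set W) S \<psi>"
    using assms(2) by (simp add: homeomorphic_maps_def continuous_map_in_subtopology)
  show "\<phi> x \<in> W \<and> \<psi> (\<phi> x) = x" if "x \<in> U" for x
    using assms(2) that U unfolding homeomorphic_maps_def continuous_map_def by fastforce
  show "\<psi> w \<in> U \<and> \<phi> (\<psi> w) = w" if "w \<in> W" for w
    using assms(2) that U unfolding homeomorphic_maps_def continuous_map_def by fastforce
  have "open_map (top_of_set W) (subtopology S U) \<psi>"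
    using assms(2) homeomorphic_imp_open_map homeomorphic_maps_map by blast
  then show "openin S (\<psi> ` T)" if "openin (top_of_set W) T" for T
    using that assms(1) by (meson open_map_def openin_trans_full)
qed

text \<open>
  Charts reduce this to Brouwer's theorem in the plane.  It gives the openness of open faces and of
  the image of the open disc under a parametrisation of a removed disc.
\<close>

lemma invariance_of_domain_surface:
  fixes h :: "complex \<Rightarrow> 'a"
  assumes S: "closed_surface S" and D: "open D" and h: "continuous_map (top_of_set D) S h" "inj_on h D"
  shows "openin S (h ` D)"
proof (subst openin_subopen, intro ballI)
  fix x assume "x \<in> h ` D"
  then obtain z where z: "z \<in> D" "x = h z" by blast
  have "x \<in> topspace S"
    using h(1) z by (auto simp: continuous_map_def)
  obtain U and W :: "complex set" and \<phi> \<psi> where U: "openin S U" "x \<in> U" "open W"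
    and hom: "homeomorphic_maps (subtopology S U) (top_of_set W) \<phi> \<psi>"
    by (rule surface_chart[OF S \<open>x \<in> topspace S\<close>])
  note chart = homeomorphic_maps_chartD[OF U(1) hom]
  define D' where "D' = {z \<in> D. h z \<in> U}"
  have D': "open D'"
    using openin_continuous_map_preimage[OF h(1) U(1)] D unfolding D'_def
    by (metis openin_open_trans topspace_euclidean_subtopology)
  have "continuous_map (top_of_set D') (subtopology S U) h"
    using h(1) by (auto simp: continuous_map_in_subtopology D'_def intro: continuous_map_from_subtopology_mono)
  then have "continuous_map (top_of_set D') (top_of_set W) (\<phi> \<circ> h)"
    using chart(1) continuous_map_compose by blast
  then have "continuous_on D' (\<phi> \<circ> h)"
    by (simp add: continuous_map_in_subtopology)
  moreover have "inj_on (\<phi> \<circ> h) D'"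
    using h(2) chart(3) unfolding inj_on_def D'_def by (metis (mono_tags, lifting) comp_apply mem_Collect_eq)
  ultimately have "open ((\<phi> \<circ> h) ` D')"
    using D' invariance_of_domain by blast
  moreover have "(\<phi> \<circ> h) ` D' \<subseteq> W"
    using chart(3) by (auto simp: D'_def)
  ultimately have "openin S (\<psi> ` (\<phi> \<circ> h) ` D')"
    by (intro chart(5)) (simp add: open_openin_trans open_subset)
  moreover have "\<psi> ` (\<phi> \<circ> h) ` D' = h ` D'"
    using chart(3) by (force simp: D'_def image_iff)
  ultimately show "\<exists>T. openin S T \<and> x \<in> T \<and> T \<subseteq> h ` D"
    using z U(2) by (intro exI[of _ "h ` D'"]) (auto simp: D'_def)
qed

text \<open>
  In a chart around a point coming from the unit circle, an identification with the disc becomes an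
  injective map from an open subset of the plane into the closed disc.  Its image would be open, yet
  it contains a point of the circle.
\<close>

lemma surface_not_disc:
  assumes S: "closed_surface S"
  shows "\<not> S homeomorphic_space top_of_set (cball (0::complex) 1)"
proof
  assume "S homeomorphic_space top_of_set (cball (0::complex) 1)"
  then obtain k h where kh: "homeomorphic_maps S (top_of_set (cball (0::complex) 1)) k h"
    unfolding homeomorphic_space_def by blast
  have "h 1 \<in> topspace S"
    using kh unfolding homeomorphic_maps_def continuous_map_def by fastforce
  obtain U and W :: "complex set" and \<phi> \<psi> where U: "openin S U" "h 1 \<in> U" "open W"
    and hom: "homeomorphic_maps (subtopology S U) (top_of_set W) \<phi> \<psi>"
    by (rule surface_chart[OF S \<open>h 1 \<in> topspace S\<close>])
  note chart = homeomorphic_maps_chartD[OF U(1) hom]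
  have k: "continuous_map S (top_of_set (cball 0 1)) k" "\<And>x. x \<in> topspace S \<Longrightarrow> h (k x) = x"
    "k (h 1) = 1"
    using kh unfolding homeomorphic_maps_def by auto
  have US: "U \<subseteq> topspace S"
    using U(1) openin_subset by blast
  have "continuous_map (top_of_set W) (top_of_set (cball 0 1)) (k \<circ> \<psi>)"
    using chart(2) k(1) continuous_map_compose by blast
  then have cont: "continuous_on W (k \<circ> \<psi>)" and sub: "(k \<circ> \<psi>) ` W \<subseteq> cball 0 1"
    by (auto simp: continuous_map_in_subtopology)
  have "inj_on (k \<circ> \<psi>) W"
    using k(2) chart(4) US unfolding inj_on_def by (metis (no_types, opaque_lifting) comp_apply in_mono)
  then have "open ((k \<circ> \<psi>) ` W)"
    using cont U(3) invariance_of_domain by blast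
  moreover have "1 \<in> (k \<circ> \<psi>) ` W"
    using U(2) chart(3) k(3) by (metis comp_apply image_eqI)
  ultimately have "1 \<in> interior (cball (0::complex) 1)"
    using sub interior_maximal by blast
  then show False by simp
qed

lemma surface_open_infinite:
  assumes S: "closed_surface S" and T: "openin S T" "T \<noteq> {}"
  shows "infinite T"
proof -
  obtain x where x: "x \<in> T" "x \<in> topspace S"
    using T openin_subset by blast
  obtain U and W :: "complex set" and \<phi> \<psi> where U: "openin S U" "x \<in> U" "open W"
    and hom: "homeomorphic_maps (subtopology S U) (top_of_set W) \<phi> \<psi>"
    by (rule surface_chart[OF S x(2)])
  note chart = homeomorphic_maps_chartD[OF U(1) hom]
  have "openin (top_of_set W) {w \<in> W. \<psi> w \<in> T}"
    using openin_continuous_map_preimage[OF chart(2) T(1)] by simp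
  then have "open {w \<in> W. \<psi> w \<in> T}"
    using U(3) openin_open_trans by blast
  moreover have "\<phi> x \<in> {w \<in> W. \<psi> w \<in> T}"
    using x(1) U(2) chart(3) by auto
  ultimately have "infinite {w \<in> W. \<psi> w \<in> T}"
    by (metis empty_iff finite_imp_not_open)
  moreover have "inj_on \<psi> {w \<in> W. \<psi> w \<in> T}"
    using chart(4) by (metis (no_types, lifting) inj_onI mem_Collect_eq)
  ultimately show ?thesis
    by (metis (no_types, lifting) finite_imageD finite_subset image_subsetI mem_Collect_eq)
qed

text \<open>
  A ball of the plane with finitely many points deleted is connected, so around every deleted point
  only one of \<open>P\<close> and \<open>Q\<close> is present.  The deleted points can thus be given back to \<open>P\<close> or \<open>Q\<close>,
  which would separate the surface itself.
\<close>

lemma surface_minus_finite_connected: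
  assumes S: "closed_surface S" and F: "finite F"
    and P: "openin S P" and Q: "openin S Q"
    and PQ: "P \<inter> Q = {}" "P \<union> Q = topspace S - F"
  shows "P = {} \<or> Q = {}"
proof -
  have loc: "\<exists>U. openin S U \<and> x \<in> U \<and> (U - F \<subseteq> P \<or> U - F \<subseteq> Q)" if xS: "x \<in> topspace S" for x
  proof -
    obtain U and W :: "complex set" and \<phi> \<psi> where U: "openin S U" "x \<in> U" "open W"
      and hom: "homeomorphic_maps (subtopology S U) (top_of_set W) \<phi> \<psi>"
      by (rule surface_chart[OF S xS])
    note chart = homeomorphic_maps_chartD[OF U(1) hom]
    obtain r where r: "r > 0" "ball (\<phi> x) r \<subseteq> W"
      using U(2,3) chart(3) open_contains_ball by blast
    let ?b = "ball (\<phi> x) r"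
    define N where "N = \<psi> ` ?b"
    have N: "openin S N" "x \<in> N"
      unfolding N_def using r chart(3)[OF U(2)]
      by (auto intro!: chart(5) open_subset image_eqI[of x \<psi> "\<phi> x"])
    have "finite (\<phi> ` (F \<inter> U))" using F by blast
    then have "connected (?b - \<phi> ` (F \<inter> U))"
      by (intro connected_open_delete_finite) auto
    then have "connectedin (top_of_set W) (?b - \<phi> ` (F \<inter> U))"
      using r(2) by (simp add: connectedin_subtopology subset_iff)
    then have "connectedin S (\<psi> ` (?b - \<phi> ` (F \<inter> U)))"
      using chart(2) connectedin_continuous_map_image by blast
    moreover have "\<psi> ` (?b - \<phi> ` (F \<inter> U)) = N - F"
    proof (intro equalityI subsetI)
      fix y assume "y \<in> \<psi> ` (?b - \<phi> ` (F \<inter> U))"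
      then obtain w where w: "w \<in> ?b" "w \<notin> \<phi> ` (F \<inter> U)" "y = \<psi> w" by blast
      then have "y \<in> U" "\<phi> y = w" using chart(4) r(2) by auto
      then have "y \<notin> F" using w(2) by blast
      then show "y \<in> N - F" using w by (auto simp: N_def)
    next
      fix y assume "y \<in> N - F"
      then obtain w where w: "w \<in> ?b" "y = \<psi> w" "y \<notin> F" by (auto simp: N_def)
      then have "w \<notin> \<phi> ` (F \<inter> U)" using chart(3) by auto
      then show "y \<in> \<psi> ` (?b - \<phi> ` (F \<inter> U))" using w by blast
    qed
    ultimately have "connectedin S (N - F)" by simp
    moreover have "N - F \<subseteq> P \<union> Q"
      using N(1) PQ(2) openin_subset by fastforce
    ultimately have "P \<inter> (N - F) = {} \<or> Q \<inter> (N - F) = {}"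
      using P Q PQ(1) unfolding connectedin by blast
    then have "N - F \<subseteq> P \<or> N - F \<subseteq> Q"
      using \<open>N - F \<subseteq> P \<union> Q\<close> by blast
    then show ?thesis using N by blast
  qed
  define P' where "P' = \<Union>{U. openin S U \<and> U - F \<subseteq> P}"
  define Q' where "Q' = \<Union>{U. openin S U \<and> U - F \<subseteq> Q}"
  have "openin S P'" "openin S Q'"
    unfolding P'_def Q'_def by auto
  moreover have "topspace S \<subseteq> P' \<union> Q'"
    unfolding P'_def Q'_def using loc by blast
  moreover have "P' \<inter> Q' = {}"
  proof (rule ccontr)
    assume "P' \<inter> Q' \<noteq> {}"
    moreover have "openin S (P' \<inter> Q')" using calculation \<open>openin S P'\<close> \<open>openin S Q'\<close> by blast
    ultimately have "infinite (P' \<inter> Q')" using surface_open_infinite S by blast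
    moreover have "P' \<inter> Q' \<subseteq> F" unfolding P'_def Q'_def using PQ(1) by blast
    ultimately show False using F finite_subset by blast
  qed
  moreover have "connected_space S" using S by (simp add: closed_surface_def)
  ultimately have "P' = {} \<or> Q' = {}"
    unfolding connected_space_def by blast
  moreover have "P \<subseteq> P'" "Q \<subseteq> Q'"
    unfolding P'_def Q'_def using P Q by blast+
  ultimately show ?thesis by blast
qed

text \<open>
  By invariance of domain the open disc is mapped to an open set, hence into the interior.
\<close>

lemma disc_frontier_subset_circle:
  fixes h :: "complex \<Rightarrow> 'a"
  assumes S: "closed_surface S" and B: "B \<subseteq> topspace S" "closedin S B"
    and h: "homeomorphic_maps (subtopology S B) (top_of_set (cball 0 1)) k h"
  shows "S frontier_of B \<subseteq> h ` sphere 0 1"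
proof -
  have "topspace (subtopology S B) = B" using B by auto
  then have kh: "continuous_map (top_of_set (cball 0 1)) (subtopology S B) h"
    "\<And>x. x \<in> B \<Longrightarrow> k x \<in> cball 0 1 \<and> h (k x) = x" "\<And>z. z \<in> cball 0 1 \<Longrightarrow> h z \<in> B \<and> k (h z) = z"
    using h unfolding homeomorphic_maps_def continuous_map_def by fastforce+
  have "openin S (h ` ball 0 1)"
  proof (rule invariance_of_domain_surface[OF S])
    show "continuous_map (top_of_set (ball 0 1)) S h"
      using kh(1) by (meson ball_subset_cball continuous_map_from_subtopology_mono continuous_map_in_subtopology)
    show "inj_on h (ball 0 1)" by (metis ball_subset_cball inj_onI kh(3) subsetD)
  qed auto
  moreover have "h ` ball 0 1 \<subseteq> B" using kh(3) by (meson ball_subset_cball image_subsetI subset_iff)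
  ultimately have int: "h ` ball 0 1 \<subseteq> S interior_of B" by (simp add: interior_of_maximal)
  show ?thesis
  proof
    fix x assume "x \<in> S frontier_of B"
    then have x: "x \<in> B" "x \<notin> S interior_of B"
      using B by (auto simp: frontier_of_def closure_of_closedin)
    then have "k x \<notin> ball 0 1" using int kh(2) by (metis image_eqI subsetD)
    then show "x \<in> h ` sphere 0 1"
      using kh(2)[OF x(1)] by (intro image_eqI[of _ _ "k x"]) auto
  qed
qed

section \<open>Boundaries of sets of faces\<close>

lemma count_list_map_distinct:
  "distinct w \<Longrightarrow> count_list (map h w) v = card {d \<in> set w. h d = v}"
  by (simp add: count_list_eq_length_filter filter_map distinct_length_filter Collect_conj_eq
      Int_commute comp_def eq_commute[of v])

lemma count_list_rotate1: "count_list (rotate1 xs) x = count_list xs x"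
  by (cases xs) auto

lemma even_card_sym_diff:
  assumes "finite A" "finite B"
  shows "even (card (sym_diff A B)) \<longleftrightarrow> (even (card A) \<longleftrightarrow> even (card B))"
proof -
  have "card (sym_diff A B) = card (A - B) + card (B - A)"
    using assms by (intro card_Un_disjoint) auto
  moreover have "card A = card (A - B) + card (A \<inter> B)" "card B = card (B - A) + card (A \<inter> B)"
    using assms by (metis card_Int_Diff add.commute Int_commute)+
  ultimately show ?thesis by auto
qed

locale cellular_graph =
  fixes G :: "('a, 'e, 'f) embedded_graph"
  assumes cellular: "cellular_embedding G"
begin

lemma surface: "closed_surface (surf G)"
  and graph: "graph_in_surface G" and cells: "cellular_faces G" and oriented: "coherently_oriented G"
  using cellular by (auto simp: cellular_embedding_def)

lemma Hausdorff: "Hausdorff_space (surf G)"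
  using surface by (simp add: closed_surface_def)

lemma finite_verts: "finite (verts G)" and finite_edges: "finite (edges G)"
  and finite_faces: "finite (faces G)" and verts_subset: "verts G \<subseteq> topspace (surf G)"
  using graph cells by (auto simp: graph_in_surface_def cellular_faces_def)

text \<open>
  A dart is a directed edge.  Coherent orientation means that every dart occupies exactly one
  position in exactly one boundary walk.
\<close>

lemma dart_position:
  assumes "d \<in> edges G \<times> UNIV"
  obtains f k where "f \<in> faces G" "k < length (fwalk G f)" "fwalk G f ! k = d"
    "\<And>f' k'. f' \<in> faces G \<Longrightarrow> k' < length (fwalk G f') \<Longrightarrow> fwalk G f' ! k' = d \<Longrightarrow> f' = f \<and> k' = k"
proof -
  have "\<exists>!(f, k). f \<in> faces G \<and> k < length (fwalk G f) \<and> fwalk G f ! k = d"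
    using oriented assms unfolding coherently_oriented_def by (rule bspec)
  then obtain q where q: "case q of (f, k) \<Rightarrow> f \<in> faces G \<and> k < length (fwalk G f) \<and> fwalk G f ! k = d"
    "\<And>q'. (case q' of (f, k) \<Rightarrow> f \<in> faces G \<and> k < length (fwalk G f) \<and> fwalk G f ! k = d) \<Longrightarrow> q' = q"
    by (elim ex1E) blast
  obtain f k where fk: "q = (f, k)" by (cases q)
  show thesis
  proof (rule that[of f k])
    fix f' k' assume "f' \<in> faces G" "k' < length (fwalk G f')" "fwalk G f' ! k' = d"
    then have "(f', k') = q" by (intro q(2)) simp
    then show "f' = f \<and> k' = k" using fk by simp
  qed (use q(1) fk in auto)
qed

lemma left_face_eqI:
  assumes "f \<in> faces G" "d \<in> set (fwalk G f)"
  shows "left_face G d = f"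
  unfolding left_face_def
proof (rule the_equality)
  have "d \<in> edges G \<times> UNIV"
    using assms cells by (auto simp: cellular_faces_def)
  then obtain f0 where "\<And>f'. f' \<in> faces G \<Longrightarrow> d \<in> set (fwalk G f') \<Longrightarrow> f' = f0"
    using dart_position by (metis in_set_conv_nth)
  then show "f' = f" if "f' \<in> faces G \<and> d \<in> set (fwalk G f')" for f'
    using that assms by blast
qed (use assms in blast)

lemma left_face:
  assumes "d \<in> edges G \<times> UNIV"
  shows "left_face G d \<in> faces G" "d \<in> set (fwalk G (left_face G d))"
proof -
  obtain f where "f \<in> faces G" "d \<in> set (fwalk G f)"
    using dart_position[OF assms] by (metis nth_mem)
  then show "left_face G d \<in> faces G" "d \<in> set (fwalk G (left_face G d))"
    using left_face_eqI by auto
qed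

lemma fwalk_dart:
  assumes "f \<in> faces G" "d \<in> set (fwalk G f)"
  shows "d \<in> edges G \<times> UNIV" "left_face G d = f"
  using assms cells left_face_eqI by (auto simp: cellular_faces_def)

lemma left_face_in_faces: "e \<in> edges G \<Longrightarrow> left_face G (e, b) \<in> faces G"
  by (simp add: left_face(1))

lemma distinct_fwalk:
  assumes f: "f \<in> faces G" shows "distinct (fwalk G f)"
  unfolding distinct_conv_nth
proof (intro allI impI notI)
  fix i j assume ij: "i < length (fwalk G f)" "j < length (fwalk G f)" "i \<noteq> j"
    "fwalk G f ! i = fwalk G f ! j"
  have "fwalk G f ! i \<in> edges G \<times> UNIV"
    using fwalk_dart(1)[OF f] ij nth_mem by blast
  then show False using dart_position f ij by metis
qed

lemma set_fwalk: "f \<in> faces G \<Longrightarrow> set (fwalk G f) = {d \<in> edges G \<times> UNIV. left_face G d = f}"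
  using left_face fwalk_dart by blast

lemma count_fwalk:
  assumes "f \<in> faces G" "e \<in> edges G"
  shows "count_list (map fst (fwalk G f)) e
    = of_bool (left_face G (e, True) = f) + of_bool (left_face G (e, False) = f)"
proof -
  have "{d \<in> set (fwalk G f). fst d = e} =
      (if left_face G (e, True) = f then {(e, True)} else {}) \<union>
      (if left_face G (e, False) = f then {(e, False)} else {})"
    using assms by (auto simp: set_fwalk) (metis (full_types))+
  then show ?thesis
    using assms by (simp add: count_list_map_distinct distinct_fwalk)
qed

text \<open>
  The cellular boundary modulo 2 of a set of faces in the closed surface: an edge that has the same
  face on both sides is met twice and cancels.
\<close>

definition boundary_edges :: "'f set \<Rightarrow> 'e set" where
  "boundary_edges X = {e \<in> edges G. (left_face G (e, True) \<in> X) \<noteq> (left_face G (e, False) \<in> X)}"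

lemma boundary_edges_iff:
  "e \<in> boundary_edges X \<longleftrightarrow>
     e \<in> edges G \<and> (\<exists>b. left_face G (e, b) \<in> X \<and> left_face G (e, \<not> b) \<notin> X)"
  unfolding boundary_edges_def ex_bool_eq by auto

lemma odd_count_fwalk:
  assumes "X \<subseteq> faces G" "e \<in> edges G"
  shows "odd (\<Sum>f\<in>X. count_list (map fst (fwalk G f)) e) \<longleftrightarrow> e \<in> boundary_edges X"
proof -
  have fin: "finite X" using assms finite_faces finite_subset by blast
  have "(\<Sum>f\<in>X. count_list (map fst (fwalk G f)) e)
      = (\<Sum>f\<in>X. of_bool (left_face G (e, True) = f) + of_bool (left_face G (e, False) = f))"
    using assms by (intro sum.cong) (auto simp: count_fwalk)
  also have "\<dots> = of_bool (left_face G (e, True) \<in> X) + of_bool (left_face G (e, False) \<in> X)"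
    using fin by (simp add: sum.distrib of_bool_def sum.delta)
  finally show ?thesis using assms(2) by (auto simp: boundary_edges_def)
qed

text \<open>
  The end of each of the equal arcs of the unit circle is the beginning of the next one, cyclically.
\<close>

lemma fwalk_closed:
  assumes "f \<in> faces G"
  shows "map (\<lambda>d. dpath G d 1) (fwalk G f) = rotate1 (map (\<lambda>d. dpath G d 0) (fwalk G f))"
proof (rule nth_equalityI)
  let ?w = "fwalk G f"
  let ?n = "length ?w"
  have w: "\<And>k t. k < ?n \<Longrightarrow> t \<in> {0..1} \<Longrightarrow>
      fmap G f (cis (2 * pi * (real k + t) / real ?n)) = dpath G (?w ! k) t"
    using cells assms by (auto simp: cellular_faces_def)
  fix k assume "k < length (map (\<lambda>d. dpath G d 1) ?w)"
  then have k: "k < ?n" by simp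
  then have k': "Suc k mod ?n < ?n" by (intro mod_less_divisor) linarith
  have "cis (2 * pi * (real k + 1) / real ?n) = cis (2 * pi * (real (Suc k mod ?n) + 0) / real ?n)"
  proof (cases "Suc k < ?n")
    case False
    then have "Suc k = ?n" using k by simp
    then have *: "real k + 1 = real ?n" by simp
    moreover have "0 < real ?n" using \<open>Suc k = ?n\<close> by linarith
    ultimately show ?thesis by (simp add: * \<open>Suc k = ?n\<close>)
  qed (simp add: add.commute)
  then have "dpath G (?w ! k) 1 = dpath G (?w ! (Suc k mod ?n)) 0"
    using w[OF k, of 1] w[OF k', of 0] by simp
  then show "map (\<lambda>d. dpath G d 1) ?w ! k = rotate1 (map (\<lambda>d. dpath G d 0) ?w) ! k"
    using k k' by (simp add: nth_rotate1)
qed simp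

lemma degree_in_darts:
  assumes "finite P"
  shows "degree_in G P v = card {d \<in> P \<times> UNIV. dpath G d 0 = v}"
proof -
  have "{d \<in> P \<times> UNIV. dpath G d 0 = v} =
      (\<lambda>e. (e, True)) ` {e \<in> P. epath G e 0 = v} \<union> (\<lambda>e. (e, False)) ` {e \<in> P. epath G e 1 = v}"
    by (auto simp: dpath_def image_iff split: if_splits)
  also have "card \<dots> = card {e \<in> P. epath G e 0 = v} + card {e \<in> P. epath G e 1 = v}"
    using assms by (subst card_Un_disjoint) (auto simp: card_image inj_on_def)
  finally show ?thesis by (simp add: degree_in_def)
qed

lemma degree_in_sym_diff:
  assumes "finite P" "finite Q"
  shows "even (degree_in G (sym_diff P Q) v) \<longleftrightarrow> (even (degree_in G P v) \<longleftrightarrow> even (degree_in G Q v))"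
proof -
  define D where "D = (\<lambda>P. {d \<in> P \<times> (UNIV :: bool set). dpath G d 0 = v})"
  have "D (sym_diff P Q) = sym_diff (D P) (D Q)" by (auto simp: D_def)
  moreover have "finite (D P)" "finite (D Q)" using assms by (auto simp: D_def)
  moreover have deg: "degree_in G R v = card (D R)" if "finite R" for R
    unfolding D_def by (rule degree_in_darts[OF that])
  ultimately show ?thesis
    using even_card_sym_diff[of "D P" "D Q"] by (simp add: deg assms)
qed

text \<open>
  This is \<open>\<partial>\<partial> = 0\<close>.  Every boundary walk leaves a vertex as often as it enters it.  Hence the darts
  starting at \<open>v\<close> with \<open>X\<close> on their left are as numerous as those ending at \<open>v\<close>, or, after reversal,
  as the darts starting at \<open>v\<close> with \<open>X\<close> on their right.  The darts of the boundary of \<open>X\<close> starting at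
  \<open>v\<close> form the symmetric difference of these two sets.
\<close>

lemma degree_boundary_edges_even:
  assumes X: "X \<subseteq> faces G"
  shows "even (degree_in G (boundary_edges X) v)"
proof -
  define D where "D = edges G \<times> (UNIV :: bool set)"
  have finD: "finite D" using finite_edges by (simp add: D_def)
  have finX: "finite X" using X finite_faces finite_subset by blast
  define r :: "'e \<times> bool \<Rightarrow> 'e \<times> bool" where "r = (\<lambda>d. (fst d, \<not> snd d))"
  define A where "A = {d \<in> D. left_face G d \<in> X \<and> dpath G d 0 = v}"
  define A' where "A' = {d \<in> D. left_face G d \<in> X \<and> dpath G d 1 = v}"
  have per_face: "card {d \<in> set (fwalk G f). dpath G d 0 = v} = card {d \<in> set (fwalk G f). dpath G d 1 = v}"
    if "f \<in> X" for f
  proof -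
    have f: "f \<in> faces G" using that X by auto
    have "count_list (map (\<lambda>d. dpath G d 1) (fwalk G f)) v = count_list (map (\<lambda>d. dpath G d 0) (fwalk G f)) v"
      by (simp add: fwalk_closed[OF f] count_list_rotate1)
    then show ?thesis using distinct_fwalk[OF f] by (simp add: count_list_map_distinct)
  qed
  have split: "card {d \<in> D. left_face G d \<in> X \<and> q d} = (\<Sum>f\<in>X. card {d \<in> set (fwalk G f). q d})" for q
  proof -
    have "{d \<in> D. left_face G d \<in> X \<and> q d} = (\<Union>f\<in>X. {d \<in> set (fwalk G f). q d})"
      using X by (auto simp: D_def set_fwalk subset_iff)
    moreover have "{d \<in> set (fwalk G f). q d} \<inter> {d \<in> set (fwalk G f'). q d} = {}"
      if "f \<in> X" "f' \<in> X" "f \<noteq> f'" for f f'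
      using that X by (auto simp: set_fwalk subset_iff)
    ultimately show ?thesis
      using finX by (simp add: card_UN_disjoint)
  qed
  have "card A = card A'"
    unfolding A_def A'_def split by (intro sum.cong refl per_face)
  also have "\<dots> = card (r ` A')"
    by (intro card_image[symmetric]) (auto simp: inj_on_def r_def prod_eq_iff)
  finally have eq: "card A = card (r ` A')" .
  have rA': "r ` A' = {d \<in> D. left_face G (r d) \<in> X \<and> dpath G d 0 = v}"
  proof safe
    fix d assume "d \<in> D" "left_face G (r d) \<in> X" "v = dpath G d 0"
    then show "d \<in> r ` A'"
      by (intro image_eqI[of _ _ "r d"]) (auto simp: A'_def r_def D_def dpath_def)
  qed (auto simp: A'_def r_def D_def dpath_def)
  have "{d \<in> boundary_edges X \<times> UNIV. dpath G d 0 = v} = sym_diff A (r ` A')"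
  proof (intro set_eqI)
    fix d :: "'e \<times> bool"
    obtain e b where "d = (e, b)" by (cases d)
    then show "d \<in> {d \<in> boundary_edges X \<times> UNIV. dpath G d 0 = v} \<longleftrightarrow> d \<in> sym_diff A (r ` A')"
      unfolding rA' by (cases b) (auto simp: A_def D_def boundary_edges_def r_def)
  qed
  then have "degree_in G (boundary_edges X) v = card (sym_diff A (r ` A'))"
    using finite_edges by (subst degree_in_darts) (auto simp: boundary_edges_def)
  then show ?thesis
    using even_card_sym_diff[of A "r ` A'"] eq finD by (simp add: A_def A'_def)
qed

section \<open>Closed cells and connectedness of the dual graph\<close>

lemma epath_continuous: "e \<in> edges G \<Longrightarrow> continuous_map (top_of_set {0..1}) (surf G) (epath G e)"
  and epath_ends: "e \<in> edges G \<Longrightarrow> epath G e 0 \<in> verts G" "e \<in> edges G \<Longrightarrow> epath G e 1 \<in> verts G"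
  and epath_inj: "e \<in> edges G \<Longrightarrow> inj_on (epath G e) {0<..<1}"
  and open_edge_verts: "e \<in> edges G \<Longrightarrow> open_edge G e \<inter> verts G = {}"
  and open_edges_disjoint:
    "e \<in> edges G \<Longrightarrow> e' \<in> edges G \<Longrightarrow> e \<noteq> e' \<Longrightarrow> open_edge G e \<inter> open_edge G e' = {}"
  using graph by (auto simp: graph_in_surface_def)

lemma closed_edge_eq: "closed_edge G e = open_edge G e \<union> {epath G e 0, epath G e 1}"
proof -
  have "{0..1::real} = {0<..<1} \<union> {0, 1}" by auto
  then show ?thesis by (simp add: closed_edge_def open_edge_def image_Un)
qed

lemma open_edge_nonempty: "open_edge G e \<noteq> {}"
  by (auto simp: open_edge_def)

lemma open_edge_Int_closed_edge:
  "e \<in> edges G \<Longrightarrow> e' \<in> edges G \<Longrightarrow> e \<noteq> e' \<Longrightarrow> open_edge G e \<inter> closed_edge G e' = {}"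
  using open_edges_disjoint[of e e'] open_edge_verts[of e] epath_ends[of e']
  unfolding closed_edge_eq by blast

lemma dpath_image: "dpath G d ` {0..1} = closed_edge G (fst d)"
proof -
  have "(\<lambda>t. 1 - t) ` {0..1} = {0..1::real}" by (force simp: image_iff)
  then have "(\<lambda>t. epath G (fst d) (1 - t)) ` {0..1} = epath G (fst d) ` {0..1}"
    by (metis image_image)
  then show ?thesis by (cases "snd d") (simp_all add: dpath_def closed_edge_def)
qed

lemma fmap_continuous: "f \<in> faces G \<Longrightarrow> continuous_map (top_of_set (cball 0 1)) (surf G) (fmap G f)"
  using cells by (auto simp: cellular_faces_def)

lemma fmap_homeomorphic: "f \<in> faces G \<Longrightarrow>
    homeomorphic_map (top_of_set (ball 0 1)) (subtopology (surf G) (open_face G f)) (fmap G f)"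
  using cells by (auto simp: cellular_faces_def)

lemma fmap_arc:
  assumes "f \<in> faces G" "k < length (fwalk G f)" "t \<in> {0..1}"
  shows "fmap G f (cis (2 * pi * (real k + t) / real (length (fwalk G f)))) = dpath G (fwalk G f ! k) t"
  using cells assms by (auto simp: cellular_faces_def)

lemma closed_edge_subset_face:
  assumes "f \<in> faces G" "d \<in> set (fwalk G f)"
  shows "closed_edge G (fst d) \<subseteq> closed_face G f"
proof -
  obtain k where "k < length (fwalk G f)" "fwalk G f ! k = d"
    using assms by (auto simp: in_set_conv_nth)
  then have "dpath G d t \<in> closed_face G f" if "t \<in> {0..1}" for t
    unfolding closed_face_def using fmap_arc[OF assms(1) _ that, of k]
    by (intro image_eqI[of _ _ "cis (2 * pi * (real k + t) / real (length (fwalk G f)))"]) auto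
  then show ?thesis by (auto simp flip: dpath_image)
qed

lemma fmap_sphere:
  assumes "f \<in> faces G" "z \<in> sphere 0 1"
  shows "fmap G f z \<in> verts G \<or> (\<exists>d \<in> set (fwalk G f). fmap G f z \<in> closed_edge G (fst d))"
proof (cases "fwalk G f = []")
  case True
  then show ?thesis using cells assms by (auto simp: cellular_faces_def)
next
  case False
  let ?n = "length (fwalk G f)"
  have n: "0 < ?n" using False by simp
  have z: "z = cis (Arg2pi z)"
    using assms complex_norm_eq_1_exp[of z] by (simp add: cis_conv_exp)
  define u where "u = Arg2pi z * ?n / (2 * pi)"
  have u: "0 \<le> u" "u < ?n"
    using Arg2pi[of z] n by (simp_all add: u_def field_simps)
  define k where "k = nat \<lfloor>u\<rfloor>"
  have k: "k < ?n" "u - k \<in> {0..1}"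
    using u by (auto simp: k_def) linarith+
  have "2 * pi * (real k + (u - k)) / ?n = Arg2pi z"
    using n by (simp add: u_def)
  then have "fmap G f z = dpath G (fwalk G f ! k) (u - k)"
    using fmap_arc[OF assms(1) k] z by simp
  then have "fmap G f z \<in> closed_edge G (fst (fwalk G f ! k))"
    using k(2) dpath_image by blast
  then show ?thesis using k(1) nth_mem by blast
qed

lemma open_faces_eq_components:
  "bij_betw (open_face G) (faces G)
     (connected_components_of (subtopology (surf G) (topspace (surf G) - skeleton G)))"
  using cells by (auto simp: cellular_faces_def)

lemma Union_open_faces: "(\<Union>f\<in>faces G. open_face G f) = topspace (surf G) - skeleton G"
  using Union_connected_components_of[of "subtopology (surf G) (topspace (surf G) - skeleton G)"]
    bij_betw_imp_surj_on[OF open_faces_eq_components] by auto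

lemma open_faces_disjoint:
  assumes "f \<in> faces G" "f' \<in> faces G" "f \<noteq> f'"
  shows "open_face G f \<inter> open_face G f' = {}"
proof -
  have "open_face G f \<noteq> open_face G f'"
    using inj_onD[OF bij_betw_imp_inj_on[OF open_faces_eq_components]] assms by blast
  moreover have "open_face G f'' \<in>
      connected_components_of (subtopology (surf G) (topspace (surf G) - skeleton G))"
    if "f'' \<in> faces G" for f''
    using bij_betwE[OF open_faces_eq_components] that by blast
  ultimately show ?thesis
    using pairwiseD[OF pairwise_disjoint_connected_components_of] assms disjnt_def by metis
qed

lemma closed_face_subset_open_face_skeleton:
  assumes "f \<in> faces G"
  shows "closed_face G f \<subseteq> open_face G f \<union> skeleton G"
proof
  fix x assume "x \<in> closed_face G f"
  then obtain z where z: "z \<in> cball 0 1" "x = fmap G f z" by (auto simp: closed_face_def)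
  show "x \<in> open_face G f \<union> skeleton G"
  proof (cases "z \<in> ball 0 1")
    case False
    then have "z \<in> sphere 0 1" using z by auto
    then show ?thesis
      using fmap_sphere[OF assms] z fwalk_dart[OF assms] by (fastforce simp: skeleton_def)
  qed (use z in \<open>auto simp: open_face_def\<close>)
qed

text \<open>
  The boundary of a face is mapped into the skeleton, which avoids all open faces.
\<close>

lemma open_face_Int_closed_face:
  assumes "f \<in> faces G" "f' \<in> faces G" "f \<noteq> f'"
  shows "open_face G f \<inter> closed_face G f' = {}"
  using open_faces_disjoint[OF assms] closed_face_subset_open_face_skeleton[OF assms(2)]
    Union_open_faces assms(1) by blast

lemma open_face_subset_closed_face: "open_face G f \<subseteq> closed_face G f"
  unfolding open_face_def closed_face_def by (intro image_mono ball_subset_cball)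

lemma closed_face_subset: "f \<in> faces G \<Longrightarrow> closed_face G f \<subseteq> topspace (surf G)"
  using fmap_continuous by (fastforce simp: closed_face_def continuous_map_def)

lemma openin_open_face:
  assumes "f \<in> faces G" shows "openin (surf G) (open_face G f)"
  unfolding open_face_def
proof (rule invariance_of_domain_surface[OF surface])
  show "continuous_map (top_of_set (ball 0 1)) (surf G) (fmap G f)"
    using fmap_continuous[OF assms] by (rule continuous_map_from_subtopology_mono) auto
  show "inj_on (fmap G f) (ball 0 1)"
    using fmap_homeomorphic[OF assms] by (simp add: homeomorphic_map_def)
qed auto

lemma closedin_closed_face:
  assumes "f \<in> faces G" shows "closedin (surf G) (closed_face G f)"
proof -
  have "compactin (surf G) (closed_face G f)"
    unfolding closed_face_def using fmap_continuous[OF assms]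
    by (rule image_compactin[rotated]) (simp add: compactin_subtopology)
  then show ?thesis using Hausdorff by (simp add: compactin_imp_closedin)
qed

lemma closed_face_subset_closure:
  assumes "f \<in> faces G" shows "closed_face G f \<subseteq> surf G closure_of open_face G f"
proof -
  have "top_of_set (cball (0::complex) 1) closure_of ball 0 1 = cball 0 1"
    by (simp add: closure_of_subtopology Int_absorb1)
  then show ?thesis
    using continuous_map_image_closure_subset[OF fmap_continuous[OF assms], of "ball 0 1"]
    by (simp add: closed_face_def open_face_def)
qed

lemma dual_vertex_in_open_face: "dual_vertex G f \<in> open_face G f"
  by (auto simp: dual_vertex_def open_face_def)

lemma inj_on_dual_vertex: "inj_on (dual_vertex G) (faces G)"
proof (rule inj_onI)
  fix f f' assume ff: "f \<in> faces G" "f' \<in> faces G" "dual_vertex G f = dual_vertex G f'"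
  then have "dual_vertex G f \<in> open_face G f \<inter> open_face G f'"
    using dual_vertex_in_open_face[of f] dual_vertex_in_open_face[of f'] by simp
  then show "f = f'" using open_faces_disjoint[OF ff(1,2)] by blast
qed

text \<open>
  The boundary of \<open>f\<close> runs along closed edges, and an open edge meets no vertex and no other closed
  edge.  So \<open>f\<close> reaches the point \<open>x\<close> only if its walk contains one of the two darts of \<open>e\<close>.
\<close>

lemma open_edge_sides:
  assumes "e \<in> edges G" "x \<in> open_edge G e" "f \<in> faces G" "x \<in> closed_face G f"
  obtains b where "f = left_face G (e, b)"
proof -
  obtain z where z: "z \<in> cball 0 1" "x = fmap G f z" using assms by (auto simp: closed_face_def)
  have "x \<in> skeleton G" using assms(1,2) by (auto simp: skeleton_def closed_edge_eq)
  then have "x \<notin> open_face G f" using Union_open_faces assms(3) by blast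
  then have "z \<in> sphere 0 1" using z by (auto simp: open_face_def)
  moreover have "x \<notin> verts G" using assms open_edge_verts by blast
  ultimately obtain d where d: "d \<in> set (fwalk G f)" "x \<in> closed_edge G (fst d)"
    using fmap_sphere assms(3) z by blast
  have dd: "d \<in> edges G \<times> UNIV" "left_face G d = f" using fwalk_dart[OF assms(3) d(1)] by auto
  then have "fst d = e" using open_edge_Int_closed_edge[of e "fst d"] assms d by fastforce
  then show thesis using that[of "snd d"] dd by auto
qed

lemma closed_edge_subset_left_face: "e \<in> edges G \<Longrightarrow> closed_edge G e \<subseteq> closed_face G (left_face G (e, b))"
  using left_face[of "(e, b)"] closed_edge_subset_face by fastforce

lemma faces_cover: "topspace (surf G) \<subseteq> verts G \<union> (\<Union>f\<in>faces G. closed_face G f)"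
proof -
  have "skeleton G \<subseteq> verts G \<union> (\<Union>f\<in>faces G. closed_face G f)"
    unfolding skeleton_def using closed_edge_subset_left_face left_face(1) by fastforce
  then show ?thesis
    using Union_open_faces open_face_subset_closed_face by blast
qed

lemma closedin_Union_closed_faces:
  "X \<subseteq> faces G \<Longrightarrow> closedin (surf G) (\<Union>f\<in>X. closed_face G f)"
  using finite_faces closedin_closed_face by (intro closedin_Union) (auto intro: finite_subset)

text \<open>
  If no edge separates \<open>X\<close> from the other faces, the two unions of closed faces can meet only at
  vertices.  They would then disconnect the surface with its finitely many vertices deleted.
\<close>

lemma dual_graph_connected:
  assumes X: "X \<subseteq> faces G" "boundary_edges X = {}"
  shows "X = {} \<or> X = faces G"
proof -
  define C where "C = (\<lambda>Y. \<Union>f\<in>Y. closed_face G f)"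
  define Y where "Y = faces G - X"
  have Y: "Y \<subseteq> faces G" by (auto simp: Y_def)
  have meet: "C X \<inter> C Y \<subseteq> verts G"
  proof (rule ccontr)
    assume "\<not> C X \<inter> C Y \<subseteq> verts G"
    then obtain x f f' where x: "x \<notin> verts G" "f \<in> X" "x \<in> closed_face G f" "f' \<in> Y" "x \<in> closed_face G f'"
      by (auto simp: C_def)
    then have ff: "f \<in> faces G" "f' \<in> faces G" "f \<noteq> f'" using X by (auto simp: Y_def)
    have "x \<notin> open_face G f"
      using open_face_Int_closed_face[OF ff] x by auto
    then have "x \<in> skeleton G"
      using closed_face_subset_open_face_skeleton ff(1) x by blast
    then obtain e where e: "e \<in> edges G" "x \<in> open_edge G e"
      using x(1) epath_ends by (auto simp: skeleton_def closed_edge_eq)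
    obtain b b' where "f = left_face G (e, b)" "f' = left_face G (e, b')"
      using open_edge_sides[OF e] ff x by metis
    then have "e \<in> boundary_edges X"
      using e(1) x by (cases b; cases b') (auto simp: boundary_edges_def Y_def)
    then show False using X by simp
  qed
  have cover: "topspace (surf G) \<subseteq> verts G \<union> C X \<union> C Y"
    using faces_cover by (auto simp: C_def Y_def)
  have CT: "C X \<subseteq> topspace (surf G)" "C Y \<subseteq> topspace (surf G)"
    unfolding C_def using X(1) Y closed_face_subset by blast+
  have closed: "closedin (surf G) (C X)" "closedin (surf G) (C Y)"
    unfolding C_def using X Y closedin_Union_closed_faces by auto
  have V: "closedin (surf G) (verts G)"
    using Hausdorff verts_subset finite_verts
    by (simp add: Hausdorff_imp_t1_space closedin_Hausdorff_finite)
  have op: "openin (surf G) (topspace (surf G) - C X - verts G)" "openin (surf G) (topspace (surf G) - C Y - verts G)"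
    using closed V by (auto intro: openin_diff)
  have "topspace (surf G) - C X - verts G = {} \<or> topspace (surf G) - C Y - verts G = {}"
    by (rule surface_minus_finite_connected[OF surface finite_verts op]) (use meet cover CT in auto)
  moreover have "dual_vertex G f \<notin> verts G" "dual_vertex G f \<in> topspace (surf G)" if "f \<in> faces G" for f
    using dual_vertex_in_open_face Union_open_faces that by (auto simp: skeleton_def)
  moreover have "dual_vertex G f \<notin> C X" if "f \<in> Y" for f
    using dual_vertex_in_open_face open_face_Int_closed_face that X by (fastforce simp: C_def Y_def)
  moreover have "dual_vertex G f \<notin> C Y" if "f \<in> X" for f
    using dual_vertex_in_open_face open_face_Int_closed_face that X by (fastforce simp: C_def Y_def)
  ultimately have "X = {} \<or> Y = {}"
    using X(1) Y by blast
  then show ?thesis using X by (auto simp: Y_def)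
qed

text \<open>
  The complement of \<open>B\<close> is open and contains at most the finitely many vertices, whereas nonempty
  open subsets of a surface are infinite.
\<close>

lemma closed_union_contains_surface:
  assumes "closedin (surf G) B" "(\<Union>f\<in>faces G. closed_face G f) \<subseteq> B"
  shows "B = topspace (surf G)"
proof -
  have "openin (surf G) (topspace (surf G) - B)" using assms(1) by auto
  moreover have "topspace (surf G) - B \<subseteq> verts G" using faces_cover assms(2) by blast
  ultimately have "topspace (surf G) - B = {}"
    using surface_open_infinite[OF surface] finite_verts finite_subset by blast
  then show ?thesis using closedin_subset[OF assms(1)] by blast
qed

lemma faces_nonempty: "faces G \<noteq> {}"
proof
  assume "faces G = {}"
  then have "{} = topspace (surf G)"
    using closed_union_contains_surface[of "{}"] by simp
  then show False using surface by (simp add: closed_surface_def)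
qed

end

section \<open>Arcs and circles\<close>

text \<open>
  Two paths in the line that start at the same point and end below it overlap below it, by the
  intermediate value theorem.  This forbids two edge ends at the topmost point of a graph drawn on a line.
\<close>

lemma line_peak_paths_meet:
  fixes \<alpha> \<beta> :: "real \<Rightarrow> real"
  assumes "continuous_on {0..1} \<alpha>" "continuous_on {0..1} \<beta>" "\<alpha> 0 = m" "\<beta> 0 = m" "\<alpha> 1 < m" "\<beta> 1 < m"
  obtains s t where "s \<in> {0<..1}" "t \<in> {0<..1}" "\<alpha> s = \<beta> t"
proof -
  define y where "y = max (\<alpha> 1) (\<beta> 1)"
  have y: "\<alpha> 1 \<le> y" "\<beta> 1 \<le> y" "y < m" using assms by (auto simp: y_def)
  obtain s where s: "0 \<le> s" "s \<le> 1" "\<alpha> s = y"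
    using IVT2'[of \<alpha> 1 y 0] assms y by auto
  obtain t where t: "0 \<le> t" "t \<le> 1" "\<beta> t = y"
    using IVT2'[of \<beta> 1 y 0] assms y by auto
  have "s \<noteq> 0" "t \<noteq> 0" using s t assms y by auto
  then show thesis using s t by (intro that[of s t]) auto
qed

lemma circle_minus_point_embeds_in_line:
  fixes z0 :: complex
  assumes "norm z0 = 1"
  obtains r :: "complex \<Rightarrow> real" where "continuous_on (sphere 0 1 - {z0}) r" "inj_on r (sphere 0 1 - {z0})"
proof
  \<comment> \<open>Measuring angles from the antipode of \<open>z0\<close> puts the branch cut of \<open>Arg\<close> at \<open>z0\<close>.\<close>
  define r where "r = (\<lambda>z. Arg (- z / z0))"
  have z0: "z0 \<noteq> 0" using assms by auto
  have *: "norm (- z / z0) = 1" if "z \<in> sphere 0 1 - {z0}" for z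
    using that assms by (simp add: norm_divide)
  have "- z / z0 \<notin> \<real>\<^sub>\<le>\<^sub>0" if "z \<in> sphere 0 1 - {z0}" for z
  proof
    assume "- z / z0 \<in> \<real>\<^sub>\<le>\<^sub>0"
    then obtain a where a: "- z / z0 = of_real a" "a \<le> 0" by (rule nonpos_Reals_cases)
    then have "\<bar>a\<bar> = 1" using *[OF that] by (metis norm_of_real)
    then have "- z / z0 = -1" using a by auto
    then have "z = z0" using z0 by (simp add: field_simps)
    then show False using that by simp
  qed
  then show "continuous_on (sphere 0 1 - {z0}) r"
    unfolding r_def using z0 by (intro continuous_intros) auto
  show "inj_on r (sphere 0 1 - {z0})"
  proof (rule inj_onI)
    fix z w assume zw: "z \<in> sphere 0 1 - {z0}" "w \<in> sphere 0 1 - {z0}" "r z = r w"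
    have "- z / z0 = - w / z0"
      using *[OF zw(1)] *[OF zw(2)] zw(3) unfolding r_def by (metis complex_norm_eq_1_exp_eq)
    then show "z = w" using z0 by simp
  qed
qed

context cellular_graph
begin

lemma dpath_continuous:
  assumes "fst d \<in> edges G"
  shows "continuous_map (top_of_set {0..1}) (surf G) (dpath G d)"
proof (cases "snd d")
  case False
  have "continuous_map (top_of_set {0..1}) (top_of_set {0..1::real}) (\<lambda>t. 1 - t)"
    by (auto simp: continuous_map_in_subtopology intro!: continuous_intros)
  from continuous_map_compose[OF this epath_continuous[OF assms]] show ?thesis
    using False by (simp add: dpath_def[abs_def] comp_def)
qed (use epath_continuous[OF assms] in \<open>simp add: dpath_def[abs_def]\<close>)

text \<open>
  On a line, consider the topmost point \<open>m\<close> of the drawing.  It is not interior to an edge, since the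
  two halves of the edge would overlap below \<open>m\<close>; so it is a vertex.  Two different edge ends
  there would overlap for the same reason, so its degree is one.  A loop counts as two edge ends and
  is excluded in the same way.
\<close>

lemma edges_on_line_not_even:
  fixes r :: "'a \<Rightarrow> real"
  assumes P: "P \<subseteq> edges G" "P \<noteq> {}"
    and K: "(\<Union>e\<in>P. closed_edge G e) \<subseteq> K"
    and r: "continuous_map (subtopology (surf G) K) euclidean r" "inj_on r K"
  obtains v where "odd (degree_in G P v)"
proof -
  have finP: "finite P" using P finite_edges finite_subset by blast
  define c where "c = (\<lambda>d t. r (dpath G d t))"
  define C where "C = (\<Union>d\<in>P \<times> (UNIV :: bool set). c d ` {0..1})"
  have dK: "dpath G d t \<in> K" if "fst d \<in> P" "t \<in> {0..1}" for d t
    using dpath_image[of d] that K by blast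
  have cont: "continuous_on {0..1} (c d)" if "fst d \<in> P" for d
  proof -
    have "continuous_map (top_of_set {0..1}) (subtopology (surf G) K) (dpath G d)"
      using dpath_continuous[of d] that P dK[OF that] by (auto simp: continuous_map_in_subtopology)
    from continuous_map_compose[OF this r(1)] show ?thesis
      by (simp add: c_def comp_def)
  qed
  have "compact C"
    unfolding C_def using finP cont by (intro compact_UN compact_continuous_image) auto
  moreover have "C \<noteq> {}" using P(2) by (auto simp: C_def)
  ultimately obtain m where m: "m \<in> C" "\<And>y. y \<in> C \<Longrightarrow> y \<le> m"
    using compact_attains_sup by metis
  have le: "c d t \<le> m" if "fst d \<in> P" "t \<in> {0..1}" for d t
    using that by (intro m(2)) (auto simp: C_def intro!: bexI[of _ "fst d"] exI[of _ "snd d"])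
  have inj: "d = d' \<and> s = t"
    if "fst d \<in> P" "fst d' \<in> P" "s \<in> {0<..<1/2}" "t \<in> {0<..<1/2}" "c d s = c d' t" for d d' s t
  proof -
    have eq: "dpath G d s = dpath G d' t"
      by (rule inj_onD[OF r(2)]) (use that dK in \<open>auto simp: c_def\<close>)
    define s' where "s' = (if snd d then s else 1 - s)"
    define t' where "t' = (if snd d' then t else 1 - t)"
    have s': "s' \<in> {0<..<1}" and t': "t' \<in> {0<..<1}" using that by (auto simp: s'_def t'_def)
    have eq': "epath G (fst d) s' = epath G (fst d') t'"
      using eq by (simp add: dpath_def s'_def t'_def)
    then have e: "fst d = fst d'"
      using open_edges_disjoint[of "fst d" "fst d'"] that P s' t' unfolding open_edge_def by blast
    then have "s' = t'"
      using epath_inj[of "fst d"] eq' s' t' that P by (metis inj_onD subsetD)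
    then have "snd d = snd d'" "s = t"
      using that by (auto simp: s'_def t'_def split: if_splits)
    then show ?thesis using e by (simp add: prod_eq_iff)
  qed
  have no_interior: "c d t < m" if d: "fst d \<in> P" and t: "t \<in> {0<..<1}" for d t
  proof (rule ccontr)
    assume "\<not> c d t < m"
    then have eq: "c d t = m" using le[OF d, of t] t by simp
    have inj1: "s = s'" if "s \<in> {0<..<1}" "s' \<in> {0<..<1}" "c d s = c d s'" for s s'
    proof -
      have "dpath G d s = dpath G d s'"
        by (rule inj_onD[OF r(2)]) (use that d dK in \<open>auto simp: c_def\<close>)
      moreover have "inj_on (epath G (fst d)) {0<..<1}" using epath_inj d P by blast
      ultimately show ?thesis
        using that inj_onD[of "epath G (fst d)" "{0<..<1}" "1 - s" "1 - s'"]
          inj_onD[of "epath G (fst d)" "{0<..<1}" s s']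
        by (cases "snd d") (auto simp: dpath_def)
    qed
    define \<alpha> where "\<alpha> = (\<lambda>s. c d (t - s * (t / 2)))"
    define \<beta> where "\<beta> = (\<lambda>s. c d (t + s * ((1 - t) / 2)))"
    have ra: "t - s * (t / 2) \<in> {0<..t}" if "s \<in> {0..1}" for s
    proof -
      have "s * (t / 2) \<le> 1 * (t / 2)" "0 \<le> s * (t / 2)" using that t by (auto intro!: mult_right_mono)
      then show ?thesis using t by auto
    qed
    have rb: "t + s * ((1 - t) / 2) \<in> {t..<1}" if "s \<in> {0..1}" for s
    proof -
      have "s * ((1 - t) / 2) \<le> (1 - t) / 2" "0 \<le> s * ((1 - t) / 2)"
        using that t mult_left_le_one_le[of "(1 - t) / 2" s] by auto
      moreover have "(1 - t) / 2 < 1 - t" using t by simp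
      ultimately show ?thesis unfolding atLeastLessThan_iff by linarith
    qed
    have "continuous_on {0..1} \<alpha>" unfolding \<alpha>_def
    proof (rule continuous_on_compose2[OF cont[OF d]])
      show "(\<lambda>s. t - s * (t / 2)) ` {0..1} \<subseteq> {0..1}"
      proof (intro image_subsetI)
        fix s :: real assume "s \<in> {0..1}"
        from ra[OF this] show "t - s * (t / 2) \<in> {0..1}"
          using t unfolding greaterThanAtMost_iff atLeastAtMost_iff greaterThanLessThan_iff by linarith
      qed
    qed (auto intro!: continuous_intros)
    moreover have "continuous_on {0..1} \<beta>" unfolding \<beta>_def
    proof (rule continuous_on_compose2[OF cont[OF d]])
      show "(\<lambda>s. t + s * ((1 - t) / 2)) ` {0..1} \<subseteq> {0..1}"
      proof (intro image_subsetI)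
        fix s :: real assume "s \<in> {0..1}"
        from rb[OF this] show "t + s * ((1 - t) / 2) \<in> {0..1}"
          using t unfolding atLeastLessThan_iff atLeastAtMost_iff greaterThanLessThan_iff by linarith
      qed
    qed (auto intro!: continuous_intros)
    moreover have "\<alpha> 0 = m" "\<beta> 0 = m" using eq by (auto simp: \<alpha>_def \<beta>_def)
    moreover have "\<alpha> 1 < m"
    proof -
      have "t / 2 \<in> {0<..<1}" using t by auto
      moreover have "\<alpha> 1 = c d (t / 2)" by (simp add: \<alpha>_def)
      ultimately show ?thesis using le[OF d, of "t / 2"] inj1[of "t / 2" t] eq t by force
    qed
    moreover have "\<beta> 1 < m"
    proof -
      have "t + (1 - t) / 2 \<in> {0<..<1}" using t by (auto simp: field_simps)
      moreover have "\<beta> 1 = c d (t + (1 - t) / 2)" by (simp add: \<beta>_def)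
      ultimately show ?thesis
        using le[OF d, of "t + (1 - t) / 2"] inj1[of "t + (1 - t) / 2" t] eq t by force
    qed
    ultimately obtain s s' where s: "s \<in> {0<..1}" "s' \<in> {0<..1}" "\<alpha> s = \<beta> s'"
      using line_peak_paths_meet by blast
    have "t - s * (t / 2) = t + s' * ((1 - t) / 2)"
    proof (rule inj1)
      show "c d (t - s * (t / 2)) = c d (t + s' * ((1 - t) / 2))"
        using s(3) by (simp only: \<alpha>_def \<beta>_def)
      have ss: "s \<in> {0..1}" "s' \<in> {0..1}" using s by auto
      show "t - s * (t / 2) \<in> {0<..<1}"
        using ra[OF ss(1)] t unfolding greaterThanAtMost_iff greaterThanLessThan_iff by linarith
      show "t + s' * ((1 - t) / 2) \<in> {0<..<1}"
        using rb[OF ss(2)] t unfolding atLeastLessThan_iff greaterThanLessThan_iff by linarith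
    qed
    moreover have "s * (t / 2) > 0" "s' * ((1 - t) / 2) > 0" using s t by auto
    ultimately show False by linarith
  qed
  define D where "D = {d \<in> P \<times> UNIV. c d 0 = m}"
  have "D \<noteq> {}"
  proof -
    obtain d t where d: "fst d \<in> P" "t \<in> {0..1}" "c d t = m"
      using m(1) by (auto simp: C_def)
    then have "t = 0 \<or> t = 1" using no_interior[OF d(1), of t] by force
    moreover have "c (fst d, \<not> snd d) 0 = c d 1" by (simp add: c_def dpath_def)
    ultimately have "d \<in> D \<or> (fst d, \<not> snd d) \<in> D"
      using d by (cases d) (auto simp: D_def)
    then show ?thesis by blast
  qed
  then obtain d0 where d0: "d0 \<in> D" by blast
  have "d = d0" if d: "d \<in> D" for d
  proof -
    \<comment> \<open>Only the first third of each dart is followed: the two opposite darts of one edge would meet in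
      its middle if they were followed up to there.\<close>
    have *: "continuous_on {0..1} (\<lambda>s. c d (s / 3))" "c d (0 / 3) = m" "c d (1 / 3) < m" "fst d \<in> P"
      if "d \<in> D" for d
    proof -
      show dP: "fst d \<in> P" using that by (auto simp: D_def)
      show "continuous_on {0..1} (\<lambda>s. c d (s / 3))"
        by (rule continuous_on_compose2[OF cont[OF dP]]) (auto intro!: continuous_intros)
      show "c d (0 / 3) = m" using that by (simp add: D_def)
      show "c d (1 / 3) < m" by (intro no_interior dP) auto
    qed
    obtain s t where "s \<in> {0<..1}" "t \<in> {0<..1}" "c d (s / 3) = c d0 (t / 3)"
      using line_peak_paths_meet[OF *(1)[OF d] *(1)[OF d0] *(2)[OF d] *(2)[OF d0] *(3)[OF d] *(3)[OF d0]] .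
    then show "d = d0" using inj[of d d0 "s / 3" "t / 3"] *(4)[OF d] *(4)[OF d0] by auto
  qed
  then have "D = {d0}" using d0 by blast
  moreover have "{d \<in> P \<times> UNIV. dpath G d 0 = dpath G d0 0} = D"
  proof -
    have "c d0 0 = m" using d0 by (simp add: D_def)
    then have "c d 0 = m" if "dpath G d 0 = dpath G d0 0" for d
      using that by (simp add: c_def)
    then have "{d \<in> P \<times> UNIV. dpath G d 0 = dpath G d0 0} \<subseteq> D"
      unfolding D_def by (intro Collect_mono) simp
    moreover have "d0 \<in> P \<times> UNIV" using d0 unfolding D_def by (rule CollectE) simp
    then have "D \<subseteq> {d \<in> P \<times> UNIV. dpath G d 0 = dpath G d0 0}"
      unfolding \<open>D = {d0}\<close> by simp
    ultimately show ?thesis by blast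
  qed
  ultimately have "degree_in G P (dpath G d0 0) = 1"
    using finP by (simp add: degree_in_darts)
  then show thesis by (intro that[of "dpath G d0 0"]) simp
qed

end

section \<open>Cells of the surface with boundary\<close>

locale surface_with_discs = cellular_graph G
  for G :: "('a, 'e, 'f) embedded_graph" +
  fixes p :: nat and B :: "nat \<Rightarrow> 'a set"
  assumes discs: "disjoint_discs G p B"
begin

text \<open>
  A disc is only known to be the union of some family of faces; the faces contained in it form a
  canonical such family.
\<close>

definition disc_faces :: "nat \<Rightarrow> 'f set" where
  "disc_faces i = {f \<in> faces G. closed_face G f \<subseteq> B i}"

lemma disc_faces_subset: "disc_faces i \<subseteq> faces G"
  by (auto simp: disc_faces_def)

lemma disc_eq_Union:
  assumes "i < p"
  shows "B i = (\<Union>f\<in>disc_faces i. closed_face G f)"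
proof -
  obtain A where "A \<subseteq> faces G" "B i = (\<Union>f\<in>A. closed_face G f)"
    using discs assms by (auto simp: disjoint_discs_def)
  then show ?thesis by (auto simp: disc_faces_def)
qed

lemma disc_closed: "i < p \<Longrightarrow> closedin (surf G) (B i)"
  using closedin_Union_closed_faces[OF disc_faces_subset] disc_eq_Union by metis

lemma disc_subset: "i < p \<Longrightarrow> B i \<subseteq> topspace (surf G)"
  using disc_closed closedin_subset by blast

lemma disc_parametrization:
  assumes "i < p"
  obtains k h where "homeomorphic_maps (subtopology (surf G) (B i)) (top_of_set (cball (0 :: complex) 1)) k h"
  using discs assms unfolding disjoint_discs_def homeomorphic_space_def by blast

lemma discs_disjoint: "i < p \<Longrightarrow> j < p \<Longrightarrow> x \<in> B i \<Longrightarrow> x \<in> B j \<Longrightarrow> i = j"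
  using discs by (auto simp: disjoint_discs_def disjoint_family_on_def)

lemma open_face_outside_disc:
  assumes "i < p" "f \<in> faces G" "f \<notin> disc_faces i"
  shows "open_face G f \<inter> B i = {}"
proof -
  have "open_face G f \<inter> closed_face G f' = {}" if "f' \<in> disc_faces i" for f'
    using open_face_Int_closed_face[of f f'] assms that disc_faces_subset by blast
  then show ?thesis using disc_eq_Union[OF assms(1)] by blast
qed

text \<open>
  The open face avoids the disc, and a closed face lies in the closure of its open face.
\<close>

lemma closed_face_outside_disc:
  assumes "i < p" "f \<in> faces G" "f \<notin> disc_faces i"
  shows "closed_face G f \<inter> surf G interior_of B i = {}"
proof -
  have "surf G interior_of B i \<inter> open_face G f = {}"
    using open_face_outside_disc[OF assms] interior_of_subset[of "surf G" "B i"] by blast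
  then have "surf G interior_of B i \<inter> surf G closure_of open_face G f = {}"
    by (simp add: openin_Int_closure_of_eq_empty)
  then show ?thesis using closed_face_subset_closure[OF assms(2)] by blast
qed

lemma open_face_inside_disc:
  assumes "f \<in> disc_faces i"
  shows "open_face G f \<subseteq> surf G interior_of B i"
proof (rule interior_of_maximal)
  show "open_face G f \<subseteq> B i"
    using assms open_face_subset_closed_face[of f] by (auto simp: disc_faces_def)
  show "openin (surf G) (open_face G f)"
    using assms by (simp add: disc_faces_def openin_open_face)
qed

lemma frontier_of_disc: "i < p \<Longrightarrow> surf G frontier_of B i = B i - surf G interior_of B i"
  using disc_closed by (simp add: frontier_of_def closure_of_closedin)

text \<open>
  With the next description of \<open>E_Sig\<close>, this replaces the topological definition of the cells of
  \<open>\<Sigma>\<close> by a combinatorial one: the dual graph of \<open>\<Sigma>\<close> is the dual graph of the closed surface with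
  the faces of the discs deleted.
\<close>

lemma F_Sig_eq: "F_Sig G p B = faces G - (\<Union>i<p. disc_faces i)"
proof (intro equalityI subsetI)
  fix f assume f: "f \<in> F_Sig G p B"
  have "f \<notin> disc_faces i" if "i < p" for i
  proof
    assume "f \<in> disc_faces i"
    then have "dual_vertex G f \<in> surf G interior_of B i"
      using open_face_inside_disc dual_vertex_in_open_face by blast
    moreover have "dual_vertex G f \<in> Sig G p B"
      using f dual_vertex_in_open_face open_face_subset_closed_face by (auto simp: F_Sig_def)
    ultimately show False using that by (auto simp: Sig_def)
  qed
  then show "f \<in> faces G - (\<Union>i<p. disc_faces i)" using f by (auto simp: F_Sig_def)
next
  fix f assume "f \<in> faces G - (\<Union>i<p. disc_faces i)"
  then show "f \<in> F_Sig G p B"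
    using closed_face_outside_disc closed_face_subset unfolding F_Sig_def Sig_def by blast
qed

lemma F_Sig_subset: "F_Sig G p B \<subseteq> faces G"
  by (auto simp: F_Sig_def)

lemma finite_F_Sig: "finite (F_Sig G p B)"
  using F_Sig_subset finite_faces finite_subset by blast

lemma finite_E_Sig: "finite (E_Sig G p B)"
  using finite_edges by (simp add: E_Sig_def)

lemma outside_F_Sig:
  assumes "f \<in> faces G" "f \<notin> F_Sig G p B"
  obtains i where "i < p" "f \<in> disc_faces i"
  using assms by (auto simp: F_Sig_eq)

lemma closed_edge_subset_disc:
  assumes "e \<in> edges G" "left_face G (e, b) \<in> disc_faces i"
  shows "closed_edge G e \<subseteq> B i"
  using closed_edge_subset_left_face[OF assms(1), of b] assms(2) by (auto simp: disc_faces_def)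

text \<open>
  Such an edge lies in a face of the disc and also in a face outside of it, which does not reach the
  interior of the disc.
\<close>

lemma boundary_edge_on_frontier:
  assumes "i < p" "e \<in> boundary_edges (disc_faces i)"
  shows "closed_edge G e \<subseteq> surf G frontier_of B i"
proof -
  obtain b where e: "e \<in> edges G" "left_face G (e, b) \<in> disc_faces i" "left_face G (e, \<not> b) \<notin> disc_faces i"
    using assms(2) by (auto simp: boundary_edges_iff)
  have "closed_edge G e \<inter> surf G interior_of B i = {}"
    using closed_edge_subset_left_face[OF e(1)] closed_face_outside_disc[OF assms(1) _ e(3)]
      left_face_in_faces[OF e(1)] by blast
  then show ?thesis
    using closed_edge_subset_disc[OF e(1,2)] by (auto simp: frontier_of_disc assms(1))
qed

text \<open>
  An edge contained in \<open>\<Sigma>\<close> with a side in a disc lies in this disc but avoids its interior, so it lies on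
  \<open>\<partial>\<Sigma>\<close>.  Conversely, an interior point of an edge whose sides are both in \<open>\<Sigma>\<close> belongs to no
  other closed face, so it does not lie in any disc.
\<close>

lemma E_Sig_eq: "E_Sig G p B = {e \<in> edges G. \<forall>b. left_face G (e, b) \<in> F_Sig G p B}"
proof (intro equalityI subsetI)
  fix e assume "e \<in> E_Sig G p B"
  then have e: "e \<in> edges G" "closed_edge G e \<subseteq> Sig G p B" "\<not> closed_edge G e \<subseteq> bd_Sig G p B"
    by (auto simp: E_Sig_def)
  have "left_face G (e, b) \<in> F_Sig G p B" for b
  proof (rule ccontr)
    assume "left_face G (e, b) \<notin> F_Sig G p B"
    then obtain i where i: "i < p" "left_face G (e, b) \<in> disc_faces i"
      using outside_F_Sig left_face_in_faces[OF e(1)] by blast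
    then have "closed_edge G e \<subseteq> surf G frontier_of B i"
      using closed_edge_subset_disc[OF e(1) i(2)] e(2) by (auto simp: frontier_of_disc Sig_def)
    then show False using e(3) i(1) by (auto simp: bd_Sig_def)
  qed
  then show "e \<in> {e \<in> edges G. \<forall>b. left_face G (e, b) \<in> F_Sig G p B}" using e by blast
next
  fix e assume "e \<in> {e \<in> edges G. \<forall>b. left_face G (e, b) \<in> F_Sig G p B}"
  then have e: "e \<in> edges G" "\<And>b. left_face G (e, b) \<in> F_Sig G p B" by auto
  have "closed_edge G e \<subseteq> Sig G p B"
    using closed_edge_subset_left_face[OF e(1), of True] e(2)[of True] by (auto simp: F_Sig_def)
  moreover obtain x where x: "x \<in> open_edge G e" using open_edge_nonempty by blast
  moreover have "x \<notin> bd_Sig G p B"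
  proof
    assume "x \<in> bd_Sig G p B"
    then obtain i where i: "i < p" "x \<in> B i"
      unfolding bd_Sig_def using frontier_of_disc by blast
    then obtain f where f: "f \<in> disc_faces i" "x \<in> closed_face G f"
      using disc_eq_Union by blast
    then obtain b where "f = left_face G (e, b)"
      using open_edge_sides[OF e(1) x] disc_faces_subset by blast
    then show False using e(2)[of b] f(1) i(1) by (auto simp: F_Sig_eq)
  qed
  ultimately show "e \<in> E_Sig G p B"
    using e(1) by (auto simp: E_Sig_def closed_edge_eq)
qed

lemma rel_boundary2_eq:
  assumes "X \<subseteq> F_Sig G p B"
  shows "rel_boundary2 G p B X = boundary_edges X \<inter> E_Sig G p B"
proof -
  have "X \<subseteq> faces G" using assms F_Sig_subset by blast
  then show ?thesis
    using odd_count_fwalk[of X] by (auto simp: rel_boundary2_def E_Sig_def)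
qed

lemma boundary_edge_outside_E_Sig:
  assumes "X \<subseteq> F_Sig G p B" "e \<in> boundary_edges X" "e \<notin> E_Sig G p B"
  obtains i where "i < p" "e \<in> boundary_edges (disc_faces i)"
proof -
  obtain b where e: "e \<in> edges G" "left_face G (e, b) \<in> X" "left_face G (e, \<not> b) \<notin> X"
    using assms(2) by (auto simp: boundary_edges_iff)
  obtain b' where "left_face G (e, b') \<notin> F_Sig G p B"
    using assms(3) e(1) by (auto simp: E_Sig_eq)
  moreover have "b' \<noteq> b" using calculation e(2) assms(1) by blast
  ultimately have "left_face G (e, \<not> b) \<notin> F_Sig G p B" by (cases b; cases b') auto
  then obtain i where i: "i < p" "left_face G (e, \<not> b) \<in> disc_faces i"
    using outside_F_Sig left_face_in_faces[OF e(1)] by blast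
  moreover have "left_face G (e, b) \<notin> disc_faces i"
    using e(2) assms(1) i(1) by (auto simp: F_Sig_eq)
  ultimately have "e \<in> boundary_edges (disc_faces i)"
    using e(1) unfolding boundary_edges_iff by (intro conjI exI[of _ "\<not> b"]) auto
  then show thesis using that i(1) by blast
qed

text \<open>
  Around a vertex that is not on \<open>\<partial>\<Sigma>\<close> the relative and the absolute boundary of \<open>X\<close> agree, as
  the edges on which they differ lie on the frontier of a disc.
\<close>

lemma rel_boundary1_boundary2:
  assumes X: "X \<subseteq> F_Sig G p B"
  shows "rel_boundary1 G p B (rel_boundary2 G p B X) = {}"
proof -
  have "even (degree_in G (rel_boundary2 G p B X) v)" if v: "v \<notin> bd_Sig G p B" for v
  proof -
    have "e \<in> E_Sig G p B" if e: "e \<in> boundary_edges X" "v \<in> {epath G e 0, epath G e 1}" for e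
    proof (rule ccontr)
      assume "e \<notin> E_Sig G p B"
      then obtain i where "i < p" "e \<in> boundary_edges (disc_faces i)"
        using boundary_edge_outside_E_Sig[OF X e(1)] by blast
      then have "v \<in> surf G frontier_of B i"
        using boundary_edge_on_frontier e(2) by (fastforce simp: closed_edge_eq)
      then show False using v \<open>i < p\<close> by (auto simp: bd_Sig_def)
    qed
    then have "{e \<in> rel_boundary2 G p B X. epath G e t = v} = {e \<in> boundary_edges X. epath G e t = v}"
      if "t = 0 \<or> t = 1" for t
      using that by (auto simp: rel_boundary2_eq[OF X])
    then have "degree_in G (rel_boundary2 G p B X) v = degree_in G (boundary_edges X) v"
      by (simp add: degree_in_def)
    then show ?thesis using degree_boundary_edges_even[of X] X F_Sig_subset by simp
  qed
  then show ?thesis by (auto simp: rel_boundary1_def)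
qed

section \<open>The kernel of the boundary operator on faces\<close>

text \<open>
  A nonempty even graph cannot be drawn on a circle minus a point, because this is a line.  So the
  edges of \<open>P\<close> cover the circle, and there is no room for the interior of another boundary edge.
\<close>

lemma even_subgraph_of_disc_boundary:
  assumes i: "i < p" and P: "P \<subseteq> boundary_edges (disc_faces i)" "P \<noteq> {}"
    and even: "\<And>v. even (degree_in G P v)"
  shows "P = boundary_edges (disc_faces i)"
proof -
  obtain k h where kh: "homeomorphic_maps (subtopology (surf G) (B i)) (top_of_set (cball (0 :: complex) 1)) k h"
    using disc_parametrization[OF i] .
  have top: "topspace (subtopology (surf G) (B i)) = B i" using disc_subset[OF i] by auto
  have k: "continuous_map (subtopology (surf G) (B i)) (top_of_set (cball 0 1)) k"
    "\<And>x. x \<in> B i \<Longrightarrow> h (k x) = x" "\<And>z. z \<in> cball 0 1 \<Longrightarrow> k (h z) = z"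
    using kh top unfolding homeomorphic_maps_def by auto
  define K where "K = (\<Union>e\<in>P. closed_edge G e)"
  have edges: "P \<subseteq> edges G" using P by (auto simp: boundary_edges_def)
  have frontier: "surf G frontier_of B i \<subseteq> h ` sphere 0 1"
    using disc_frontier_subset_circle[OF surface disc_subset[OF i] disc_closed[OF i] kh] .
  have onfr: "closed_edge G e \<subseteq> surf G frontier_of B i" if "e \<in> boundary_edges (disc_faces i)" for e
    using boundary_edge_on_frontier[OF i that] .
  then have KB: "K \<subseteq> B i" and Kcircle: "K \<subseteq> h ` sphere 0 1"
    using P(1) frontier frontier_of_disc[OF i] unfolding K_def by blast+
  have "h ` sphere 0 1 \<subseteq> K"
  proof (rule ccontr)
    assume "\<not> h ` sphere 0 1 \<subseteq> K"
    then obtain z0 where "z0 \<in> sphere 0 1" and hz0: "h z0 \<notin> K" by blast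
    then have z0: "norm z0 = 1" by simp
    obtain r :: "complex \<Rightarrow> real" where r: "continuous_on (sphere 0 1 - {z0}) r" "inj_on r (sphere 0 1 - {z0})"
      using circle_minus_point_embeds_in_line[OF z0] .
    have kK: "k ` K \<subseteq> sphere 0 1 - {z0}"
    proof
      fix z assume "z \<in> k ` K"
      then obtain x where x: "x \<in> K" "z = k x" by blast
      then obtain w where w: "w \<in> sphere 0 1" "x = h w" using Kcircle by blast
      then have "z = w" using x k(3)[of w] by simp
      then show "z \<in> sphere 0 1 - {z0}" using w x hz0 by auto
    qed
    have "continuous_map (subtopology (surf G) K) (top_of_set (sphere 0 1 - {z0})) k"
      using continuous_map_from_subtopology_mono[OF k(1) KB] kK
      by (auto simp: continuous_map_in_subtopology)
    moreover have "continuous_map (top_of_set (sphere 0 1 - {z0})) euclidean r"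
      using r(1) by simp
    ultimately have cont: "continuous_map (subtopology (surf G) K) euclidean (r \<circ> k)"
      using continuous_map_compose by blast
    have "inj_on (r \<circ> k) K"
    proof (rule comp_inj_on)
      show "inj_on k K" using k(2) KB by (metis inj_on_inverseI subsetD)
      show "inj_on r (k ` K)" using r(2) kK inj_on_subset by blast
    qed
    then obtain v where "odd (degree_in G P v)"
      using edges_on_line_not_even[OF edges P(2) _ cont] unfolding K_def by blast
    then show False using even by blast
  qed
  have "e \<in> P" if e: "e \<in> boundary_edges (disc_faces i)" for e
  proof -
    obtain x where x: "x \<in> open_edge G e" using open_edge_nonempty by blast
    then have "x \<in> K"
      using onfr[OF e] frontier \<open>h ` sphere 0 1 \<subseteq> K\<close> by (auto simp: closed_edge_eq)
    then obtain e' where e': "e' \<in> P" "x \<in> closed_edge G e'" by (auto simp: K_def)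
    have "e \<in> edges G" using e by (simp add: boundary_edges_def)
    then have "e = e'"
      using open_edge_Int_closed_edge[of e e'] x e' edges by blast
    then show ?thesis using e' by simp
  qed
  then show ?thesis using P(1) by blast
qed

text \<open>
  All edges of the absolute boundary of \<open>X\<close> lie on the frontiers of the discs.  As the discs are
  disjoint, the part \<open>P i\<close> on the \<open>i\<close>-th disc is even at every vertex, so it is empty or the whole
  boundary of that disc.  Filling in the discs of the second kind makes the boundary vanish in the
  closed surface, whose dual graph is connected.
\<close>

lemma rel_boundary2_kernel:
  assumes X: "X \<subseteq> F_Sig G p B" and zero: "rel_boundary2 G p B X = {}"
  shows "X = {} \<or> X = F_Sig G p B"
proof -
  define P where "P = (\<lambda>i. boundary_edges X \<inter> boundary_edges (disc_faces i))"
  have split: "\<exists>i<p. e \<in> P i" if "e \<in> boundary_edges X" for e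
  proof -
    have "e \<notin> E_Sig G p B" using zero that by (auto simp: rel_boundary2_eq[OF X])
    then show ?thesis
      using boundary_edge_outside_E_Sig[OF X that] that unfolding P_def by blast
  qed
  have onB: "closed_edge G e \<subseteq> B i" if "i < p" "e \<in> P i" for e i
    using boundary_edge_on_frontier[of i e] frontier_of_disc[of i] that by (auto simp: P_def)
  have even: "even (degree_in G (P i) v)" if i: "i < p" for i v
  proof (cases "v \<in> B i")
    case True
    have "e \<in> P i" if e: "e \<in> boundary_edges X" "v \<in> closed_edge G e" for e
    proof -
      obtain j where "j < p" "e \<in> P j" using split e(1) by blast
      moreover have "j = i" using onB[OF calculation] e(2) True i discs_disjoint \<open>j < p\<close> by blast
      ultimately show ?thesis by simp
    qed
    then have "{e \<in> P i. epath G e t = v} = {e \<in> boundary_edges X. epath G e t = v}"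
      if "t = 0 \<or> t = 1" for t
      using that by (auto simp: P_def closed_edge_eq)
    then have "degree_in G (P i) v = degree_in G (boundary_edges X) v"
      by (simp add: degree_in_def)
    then show ?thesis using degree_boundary_edges_even[of X] X F_Sig_subset by simp
  next
    case False
    then have "epath G e 0 \<noteq> v" "epath G e 1 \<noteq> v" if "e \<in> P i" for e
      using onB[OF i that] by (auto simp: closed_edge_eq)
    then have empty: "{e \<in> P i. epath G e 0 = v} = {}" "{e \<in> P i. epath G e 1 = v} = {}" by blast+
    have "degree_in G (P i) v = 0" by (simp only: degree_in_def empty) simp
    then show ?thesis by simp
  qed
  have all: "P i = boundary_edges (disc_faces i)" if "i < p" "P i \<noteq> {}" for i
    using even_subgraph_of_disc_boundary[OF that(1) _ that(2)] even[OF that(1)] by (simp add: P_def)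
  define Y where "Y = X \<union> (\<Union>i\<in>{i. i < p \<and> P i \<noteq> {}}. disc_faces i)"
  have YF: "Y \<subseteq> faces G" using X F_Sig_subset disc_faces_subset by (auto simp: Y_def)
  have X_disc: "f \<notin> disc_faces i" if "f \<in> F_Sig G p B" "i < p" for f i
    using that by (auto simp: F_Sig_eq)
  have "e \<notin> boundary_edges Y" for e
  proof
    assume "e \<in> boundary_edges Y"
    then obtain b where e: "e \<in> edges G" "left_face G (e, b) \<in> Y" "left_face G (e, \<not> b) \<notin> Y"
      by (auto simp: boundary_edges_iff)
    show False
    proof (cases "left_face G (e, b) \<in> X")
      case True
      then have "e \<in> boundary_edges X"
        using e by (auto simp: boundary_edges_iff Y_def)
      then obtain i where i: "i < p" "e \<in> P i" using split by blast
      then obtain b' where b': "left_face G (e, b') \<in> disc_faces i"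
        by (auto simp: P_def boundary_edges_iff)
      have "left_face G (e, b) \<notin> disc_faces i" using True X X_disc i(1) by blast
      then have "b' = (\<not> b)" using b' by (cases b; cases b') auto
      then have "left_face G (e, \<not> b) \<in> Y" using b' i unfolding Y_def by blast
      then show False using e(3) by simp
    next
      case False
      then obtain i where i: "i < p" "P i \<noteq> {}" "left_face G (e, b) \<in> disc_faces i"
        using e(2) by (auto simp: Y_def)
      have "left_face G (e, \<not> b) \<notin> disc_faces i" using e(3) i unfolding Y_def by blast
      then have "e \<in> boundary_edges (disc_faces i)" using e(1) i(3) by (auto simp: boundary_edges_iff)
      then have "e \<in> boundary_edges X" using all[OF i(1,2)] by (auto simp: P_def)
      then obtain b' where b': "left_face G (e, b') \<in> X" by (auto simp: boundary_edges_iff)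
      then have "b' = (\<not> b)" using False by (cases b; cases b') auto
      then show False using b' e(3) by (simp add: Y_def)
    qed
  qed
  then have "Y = {} \<or> Y = faces G" using dual_graph_connected[OF YF] by blast
  then show ?thesis
  proof
    assume "Y = faces G"
    have "F_Sig G p B \<subseteq> X"
    proof
      fix f assume f: "f \<in> F_Sig G p B"
      then have "f \<in> Y" using \<open>Y = faces G\<close> F_Sig_subset by blast
      then show "f \<in> X" using X_disc[OF f] by (auto simp: Y_def)
    qed
    then show ?thesis using X by blast
  qed (auto simp: Y_def)
qed

text \<open>
  If the discs used up all faces, an edge on the boundary of one of them would have another disc on
  its other side, although the discs are disjoint.  So the discs have no boundary edges, and since
  the dual graph is connected, one of them contains all faces and is the whole surface.
\<close>

lemma F_Sig_nonempty: "F_Sig G p B \<noteq> {}"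
proof
  assume empty: "F_Sig G p B = {}"
  obtain f i where i: "i < p" "f \<in> disc_faces i"
    using faces_nonempty outside_F_Sig empty by blast
  have "e \<notin> boundary_edges (disc_faces i)" for e
  proof
    assume "e \<in> boundary_edges (disc_faces i)"
    then obtain b where e: "e \<in> edges G" "left_face G (e, b) \<in> disc_faces i" "left_face G (e, \<not> b) \<notin> disc_faces i"
      by (auto simp: boundary_edges_iff)
    obtain j where j: "j < p" "left_face G (e, \<not> b) \<in> disc_faces j"
      using outside_F_Sig left_face_in_faces[OF e(1)] empty by blast
    have "i = j"
      using closed_edge_subset_disc[OF e(1,2)] closed_edge_subset_disc[OF e(1) j(2)] i(1) j(1)
        discs_disjoint[of i j "epath G e 0"] by (auto simp: closed_edge_eq)
    then show False using j(2) e(3) by simp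
  qed
  then have "disc_faces i = faces G"
    using dual_graph_connected[OF disc_faces_subset, of i] i(2) by blast
  then have "B i = topspace (surf G)"
    using closed_union_contains_surface[OF disc_closed[OF i(1)]] disc_eq_Union[OF i(1)] by simp
  moreover obtain k h where
    "homeomorphic_maps (subtopology (surf G) (B i)) (top_of_set (cball (0 :: complex) 1)) k h"
    using disc_parametrization[OF i(1)] .
  ultimately have "surf G homeomorphic_space top_of_set (cball (0 :: complex) 1)"
    unfolding homeomorphic_space_def by (metis subtopology_topspace)
  then show False using surface_not_disc[OF surface] by simp
qed

section \<open>Homology classes\<close>

lemma rel_boundary2_sym_diff:
  assumes "X \<subseteq> F_Sig G p B" "Y \<subseteq> F_Sig G p B"
  shows "rel_boundary2 G p B (sym_diff X Y) =
    sym_diff (rel_boundary2 G p B X) (rel_boundary2 G p B Y)"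
proof -
  have "sym_diff X Y \<subseteq> F_Sig G p B" using assms by blast
  then show ?thesis
    using assms by (auto simp: rel_boundary2_eq boundary_edges_def)
qed

text \<open>
  Complementary sets of faces have the same relative boundary; they correspond to the two spin
  configurations related by a global flip.
\<close>

lemma rel_boundary2_eq_iff:
  assumes "X \<subseteq> F_Sig G p B" "Y \<subseteq> F_Sig G p B"
  shows "rel_boundary2 G p B Y = rel_boundary2 G p B X \<longleftrightarrow> Y = X \<or> Y = F_Sig G p B - X"
proof
  assume "rel_boundary2 G p B Y = rel_boundary2 G p B X"
  then have "rel_boundary2 G p B (sym_diff X Y) = {}"
    using rel_boundary2_sym_diff[OF assms] by simp
  moreover have "sym_diff X Y \<subseteq> F_Sig G p B" using assms by blast
  ultimately have "sym_diff X Y = {} \<or> sym_diff X Y = F_Sig G p B"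
    using rel_boundary2_kernel by blast
  then show "Y = X \<or> Y = F_Sig G p B - X" using assms by blast
next
  assume "Y = X \<or> Y = F_Sig G p B - X"
  then show "rel_boundary2 G p B Y = rel_boundary2 G p B X"
    using assms by (auto simp: rel_boundary2_eq boundary_edges_def E_Sig_eq)
qed

lemma polygon_configs_add_boundary:
  assumes "P \<in> polygon_configs G p B" "X \<subseteq> F_Sig G p B"
  shows "sym_diff P (rel_boundary2 G p B X) \<in> polygon_configs G p B"
proof -
  let ?R = "rel_boundary2 G p B X"
  have sub: "P \<subseteq> E_Sig G p B" "?R \<subseteq> E_Sig G p B"
    using assms by (auto simp: polygon_configs_def rel_boundary2_def)
  then have "finite P" "finite ?R" using finite_E_Sig finite_subset by blast+
  note deg = degree_in_sym_diff[OF this]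
  have "even (degree_in G P v)" "even (degree_in G ?R v)" if "v \<in> V_Sig G p B - bd_Sig G p B" for v
    using assms(1) rel_boundary1_boundary2[OF assms(2)] that
    by (auto simp: polygon_configs_def rel_boundary1_def)
  then have "rel_boundary1 G p B (sym_diff P ?R) = {}"
    by (auto simp: rel_boundary1_def deg)
  then show ?thesis using sub by (auto simp: polygon_configs_def)
qed

lemma homologous_iff:
  "(P, Q) \<in> homologous G p B \<longleftrightarrow> P \<in> polygon_configs G p B \<and>
     (\<exists>X \<subseteq> F_Sig G p B. Q = sym_diff P (rel_boundary2 G p B X))"
  (is "_ \<longleftrightarrow> _ \<and> ?ex")
proof
  assume "(P, Q) \<in> homologous G p B"
  then obtain X where X: "P \<in> polygon_configs G p B" "X \<subseteq> F_Sig G p B"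
    "sym_diff P Q = rel_boundary2 G p B X"
    by (auto simp: homologous_def)
  have "Q = sym_diff P (rel_boundary2 G p B X)"
    unfolding X(3)[symmetric] by blast
  then show "P \<in> polygon_configs G p B \<and> ?ex" using X by blast
next
  assume "P \<in> polygon_configs G p B \<and> ?ex"
  then obtain X where X: "P \<in> polygon_configs G p B" "X \<subseteq> F_Sig G p B"
    and Q: "Q = sym_diff P (rel_boundary2 G p B X)" by blast
  have "sym_diff P Q = rel_boundary2 G p B X" unfolding Q by blast
  then show "(P, Q) \<in> homologous G p B"
    using polygon_configs_add_boundary[OF X] X by (auto simp: homologous_def Q)
qed

lemma equiv_homologous: "equiv (polygon_configs G p B) (homologous G p B)"
proof (rule equivI)
  show "homologous G p B \<subseteq> polygon_configs G p B \<times> polygon_configs G p B"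
    by (auto simp: homologous_def)
  show "refl_on (polygon_configs G p B) (homologous G p B)"
  proof (rule refl_onI)
    fix P assume "P \<in> polygon_configs G p B"
    moreover have "rel_boundary2 G p B {} = {}" by (simp add: rel_boundary2_def)
    ultimately show "(P, P) \<in> homologous G p B"
      unfolding homologous_iff by (intro conjI exI[of _ "{}"]) auto
  qed
  show "sym (homologous G p B)" by (rule symI) (auto simp: homologous_def Un_commute)
  show "trans (homologous G p B)"
  proof (rule transI)
    fix P Q R assume PQ: "(P, Q) \<in> homologous G p B" and QR: "(Q, R) \<in> homologous G p B"
    obtain X where X: "X \<subseteq> F_Sig G p B" "Q = sym_diff P (rel_boundary2 G p B X)"
      using PQ unfolding homologous_iff by blast
    obtain Y where Y: "Y \<subseteq> F_Sig G p B" "R = sym_diff Q (rel_boundary2 G p B Y)"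
      using QR unfolding homologous_iff by blast
    have "sym_diff X Y \<subseteq> F_Sig G p B" using X Y by blast
    moreover have "R = sym_diff P (rel_boundary2 G p B (sym_diff X Y))"
      unfolding rel_boundary2_sym_diff[OF X(1) Y(1)] Y(2) X(2) by blast
    ultimately show "(P, R) \<in> homologous G p B"
      using PQ unfolding homologous_iff by blast
  qed
qed

lemma polygon_config_of_class:
  assumes "H1_class G p B D \<in> rel_H1 G p B"
  shows "D \<in> polygon_configs G p B"
proof -
  obtain Q where "Q \<in> homologous G p B `` {D}"
    using assms in_quotient_imp_non_empty[OF equiv_homologous] by (fastforce simp: H1_class_def rel_H1_def)
  then show ?thesis by (auto simp: homologous_def)
qed

lemma polygon_configs_in_class_eq:
  assumes "D \<in> polygon_configs G p B"
  shows "polygon_configs_in_class G p B (H1_class G p B D) =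
    (\<lambda>X. sym_diff D (rel_boundary2 G p B X)) ` Pow (F_Sig G p B)"
proof -
  have "P \<in> polygon_configs_in_class G p B (H1_class G p B D) \<longleftrightarrow> (D, P) \<in> homologous G p B" for P
    using equiv_class_eq_iff[OF equiv_homologous, of D P] assms
    by (auto simp: polygon_configs_in_class_def H1_class_def)
  then show ?thesis using assms unfolding homologous_iff by auto
qed

text \<open>
  The map \<open>X \<mapsto> D + \<partial>X\<close> is two-to-one onto the polygon configurations homologous to \<open>D\<close>.
\<close>

lemma sum_over_face_sets:
  fixes w :: "'e set \<Rightarrow> real"
  assumes "D \<in> polygon_configs G p B"
  shows "(\<Sum>X\<in>Pow (F_Sig G p B). w (sym_diff D (rel_boundary2 G p B X)))
    = 2 * (\<Sum>P\<in>polygon_configs_in_class G p B (H1_class G p B D). w P)"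
proof -
  define \<phi> where "\<phi> = (\<lambda>X. sym_diff D (rel_boundary2 G p B X))"
  have fin: "finite (Pow (F_Sig G p B))" using finite_F_Sig by simp
  have fibre: "card {Y \<in> Pow (F_Sig G p B). \<phi> Y = P} = 2" if P: "P \<in> \<phi> ` Pow (F_Sig G p B)" for P
  proof -
    obtain X where X: "X \<subseteq> F_Sig G p B" "P = \<phi> X" using P by auto
    have "\<phi> Y = \<phi> X \<longleftrightarrow> rel_boundary2 G p B Y = rel_boundary2 G p B X" for Y
      unfolding \<phi>_def by blast
    then have "Y \<in> Pow (F_Sig G p B) \<and> \<phi> Y = P \<longleftrightarrow> Y = X \<or> Y = F_Sig G p B - X" for Y
      using rel_boundary2_eq_iff[OF X(1), of Y] X by blast
    then have "{Y \<in> Pow (F_Sig G p B). \<phi> Y = P} = {X, F_Sig G p B - X}" by blast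
    moreover have "X \<noteq> F_Sig G p B - X" using F_Sig_nonempty X(1) by blast
    ultimately show ?thesis by simp
  qed
  have "(\<Sum>X\<in>Pow (F_Sig G p B). w (\<phi> X))
      = (\<Sum>P\<in>\<phi> ` Pow (F_Sig G p B). \<Sum>X\<in>{X \<in> Pow (F_Sig G p B). \<phi> X = P}. w (\<phi> X))"
    using sum.image_gen[OF fin] by blast
  also have "\<dots> = (\<Sum>P\<in>\<phi> ` Pow (F_Sig G p B). 2 * w P)"
    by (intro sum.cong refl) (simp add: fibre del: Pow_iff)
  finally show ?thesis
    using polygon_configs_in_class_eq[OF assms] by (simp add: \<phi>_def sum_distrib_left)
qed

section \<open>The Ising partition function\<close>

lemma dual_V_Sig_eq: "dual_V_Sig G p B = dual_vertex G ` F_Sig G p B"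
proof -
  have "dual_vertex G f \<in> Sig G p B \<longleftrightarrow> f \<in> F_Sig G p B" if f: "f \<in> faces G" for f
  proof
    assume s: "dual_vertex G f \<in> Sig G p B"
    show "f \<in> F_Sig G p B"
    proof (rule ccontr)
      assume "f \<notin> F_Sig G p B"
      then obtain i where "i < p" "f \<in> disc_faces i" using outside_F_Sig f by blast
      then show False
        using s open_face_inside_disc dual_vertex_in_open_face by (fastforce simp: Sig_def)
    qed
  next
    assume "f \<in> F_Sig G p B"
    then show "dual_vertex G f \<in> Sig G p B"
      using dual_vertex_in_open_face open_face_subset_closed_face by (fastforce simp: F_Sig_def)
  qed
  then show ?thesis using F_Sig_subset by (auto simp: dual_V_Sig_def)
qed

text \<open>
  The interaction at \<open>e\<close> is \<open>- J e\<close> or \<open>J e\<close> according to whether \<open>e\<close> belongs to \<open>D + \<partial>X\<close>: the defect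
  and the disagreement of the two spins each change the sign once.
\<close>

lemma low_temperature_weight:
  fixes J :: "'e \<Rightarrow> real" and \<sigma> :: "'a \<Rightarrow> real"
  assumes D: "D \<subseteq> E_Sig G p B" and X: "X \<subseteq> F_Sig G p B"
    and \<sigma>: "\<And>f. f \<in> F_Sig G p B \<Longrightarrow> \<sigma> (dual_vertex G f) = (if f \<in> X then -1 else 1)"
  shows "exp (\<Sum>e\<in>E_Sig G p B. defect_sign D e * J e * \<sigma> (dual_end1 G e) * \<sigma> (dual_end2 G e))
    = (\<Prod>e\<in>E_Sig G p B. exp (J e)) *
      (\<Prod>e\<in>sym_diff D (rel_boundary2 G p B X). exp (- 2 * J e))"
proof -
  define W where "W = sym_diff D (rel_boundary2 G p B X)"
  have W: "W \<subseteq> E_Sig G p B" using D by (auto simp: W_def rel_boundary2_def)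
  have "defect_sign D e * J e * \<sigma> (dual_end1 G e) * \<sigma> (dual_end2 G e) = J e + (if e \<in> W then - 2 * J e else 0)"
    if e: "e \<in> E_Sig G p B" for e
  proof -
    have "left_face G (e, b) \<in> F_Sig G p B" "e \<in> edges G" for b using e by (auto simp: E_Sig_eq)
    then show ?thesis
      using e by (auto simp: dual_end1_def dual_end2_def \<sigma> defect_sign_def W_def rel_boundary2_eq[OF X] boundary_edges_def)
  qed
  then have "(\<Sum>e\<in>E_Sig G p B. defect_sign D e * J e * \<sigma> (dual_end1 G e) * \<sigma> (dual_end2 G e))
      = (\<Sum>e\<in>E_Sig G p B. J e) + (\<Sum>e\<in>E_Sig G p B. if e \<in> W then - 2 * J e else 0)"
    by (simp add: sum.distrib)
  also have "(\<Sum>e\<in>E_Sig G p B. if e \<in> W then - 2 * J e else 0) = (\<Sum>e\<in>W. - 2 * J e)"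
    using W finite_E_Sig by (simp add: sum.inter_restrict[symmetric] Int_absorb1)
  finally show ?thesis
    using finite_E_Sig finite_subset[OF W finite_E_Sig] by (simp add: exp_add exp_sum W_def)
qed

lemma Z_Ising_eq_sum_over_face_sets:
  assumes D: "D \<subseteq> E_Sig G p B"
  shows "Z_Ising G p B J D = (\<Sum>X\<in>Pow (F_Sig G p B). (\<Prod>e\<in>E_Sig G p B. exp (J e)) *
      (\<Prod>e\<in>sym_diff D (rel_boundary2 G p B X). exp (- 2 * J e)))"
  unfolding Z_Ising_def
proof (rule sum.reindex_bij_witness)
  define F where "F = F_Sig G p B"
  define spins where "spins = (\<lambda>X. \<lambda>v \<in> dual_vertex G ` F. if v \<in> dual_vertex G ` X then -1 else 1 :: real)"
  define minus where "minus = (\<lambda>\<sigma> :: 'a \<Rightarrow> real. {f \<in> F. \<sigma> (dual_vertex G f) = -1})"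
  have inj: "dual_vertex G f \<in> dual_vertex G ` X \<longleftrightarrow> f \<in> X" if "f \<in> F" "X \<subseteq> F" for f X
    using inj_on_image_mem_iff[OF inj_on_dual_vertex, of f X] that F_Sig_subset by (auto simp: F_def)
  fix \<sigma> :: "'a \<Rightarrow> real" assume "\<sigma> \<in> dual_V_Sig G p B \<rightarrow>\<^sub>E {-1, 1}"
  then have \<sigma>: "\<sigma> \<in> dual_vertex G ` F \<rightarrow>\<^sub>E {-1, 1}" by (simp add: dual_V_Sig_eq F_def)
  then have val: "\<sigma> (dual_vertex G f) = (if f \<in> minus \<sigma> then -1 else 1)" if "f \<in> F" for f
    using that by (auto simp: minus_def)
  show "minus \<sigma> \<in> Pow (F_Sig G p B)" by (auto simp: minus_def F_def)
  show "spins (minus \<sigma>) = \<sigma>"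
  proof (rule ext)
    fix v show "spins (minus \<sigma>) v = \<sigma> v"
    proof (cases "v \<in> dual_vertex G ` F")
      case True
      then obtain f where f: "f \<in> F" "v = dual_vertex G f" by blast
      moreover have "minus \<sigma> \<subseteq> F" by (auto simp: minus_def)
      ultimately show ?thesis using val[OF f(1)] inj[OF f(1)] by (simp add: spins_def)
    next
      case False
      then show ?thesis using PiE_arb[OF \<sigma> False] by (simp add: spins_def)
    qed
  qed
  show "(\<Prod>e\<in>E_Sig G p B. exp (J e)) *
      (\<Prod>e\<in>sym_diff D (rel_boundary2 G p B (minus \<sigma>)). exp (- 2 * J e))
    = exp (\<Sum>e\<in>E_Sig G p B. defect_sign D e * J e * \<sigma> (dual_end1 G e) * \<sigma> (dual_end2 G e))"
    using val by (intro low_temperature_weight[symmetric] D) (auto simp: minus_def F_def)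
next
  define F where "F = F_Sig G p B"
  fix X assume "X \<in> Pow (F_Sig G p B)"
  then have X: "X \<subseteq> F" by (simp add: F_def)
  have inj: "dual_vertex G f \<in> dual_vertex G ` X \<longleftrightarrow> f \<in> X" if "f \<in> F" for f
    using inj_on_image_mem_iff[OF inj_on_dual_vertex, of f X] that X F_Sig_subset by (auto simp: F_def)
  show "(\<lambda>v \<in> dual_vertex G ` F_Sig G p B. if v \<in> dual_vertex G ` X then -1 else 1 :: real)
      \<in> dual_V_Sig G p B \<rightarrow>\<^sub>E {-1, 1}"
    by (auto simp: dual_V_Sig_eq)
  show "{f \<in> F_Sig G p B. (\<lambda>v \<in> dual_vertex G ` F_Sig G p B. if v \<in> dual_vertex G ` X then -1 else 1 :: real)
      (dual_vertex G f) = -1} = X"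
    using X inj by (auto simp: F_def)
qed

end

lemma class_representative_in_class:
  assumes "homology_basis_paths G g p B \<gamma>" "\<epsilon> \<in> rel_H1 G p B"
  shows "H1_class G p B (class_representative G g p B \<gamma> \<epsilon>) = \<epsilon>"
proof -
  have "\<exists>!I. I \<subseteq> {..< 2 * g + (p - 1)} \<and>
      H1_class G p B (mod2_union (\<lambda>j. path_chain G p B (\<gamma> j)) I) = \<epsilon>"
    using assms by (simp add: homology_basis_paths_def)
  from theI'[OF this] show ?thesis by (simp add: class_representative_def)
qed

theorem proposition6:
  fixes G :: "('a, 'e, 'f) embedded_graph"
    and g p :: nat
    and B :: "nat \<Rightarrow> 'a set"
    and J :: "'e \<Rightarrow> real"
    and \<gamma> :: "nat \<Rightarrow> ('e \<times> bool) list"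
    and \<epsilon> :: "'e set set"
  assumes "cellular_embedding G" and "has_genus G g"
    and "disjoint_discs G p B"
    and "\<And>e. e \<in> edges G \<Longrightarrow> 0 < J e"
    and "homology_basis_paths G g p B \<gamma>"
    and "\<epsilon> \<in> rel_H1 G p B"
  shows "Z_Ising G p B J (class_representative G g p B \<gamma> \<epsilon>)
       = 2 * (\<Prod>e\<in>E_Sig G p B. exp (J e)) *
           (\<Sum>P\<in>polygon_configs_in_class G p B \<epsilon>. \<Prod>e\<in>P. exp (- 2 * J e))"
proof -
  interpret surface_with_discs G p B
    using assms(1,3) by unfold_locales
  define D where "D = class_representative G g p B \<gamma> \<epsilon>"
  have class_D: "H1_class G p B D = \<epsilon>"
    unfolding D_def by (rule class_representative_in_class[OF assms(5,6)])
  then have D: "D \<in> polygon_configs G p B"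
    using polygon_config_of_class assms(6) by simp
  then have "D \<subseteq> E_Sig G p B" by (simp add: polygon_configs_def)
  then have "Z_Ising G p B J D = (\<Prod>e\<in>E_Sig G p B. exp (J e)) * (\<Sum>X\<in>Pow (F_Sig G p B).
      (\<Prod>e\<in>sym_diff D (rel_boundary2 G p B X). exp (- 2 * J e)))"
    by (simp add: Z_Ising_eq_sum_over_face_sets sum_distrib_left)
  also have "(\<Sum>X\<in>Pow (F_Sig G p B).
      (\<Prod>e\<in>sym_diff D (rel_boundary2 G p B X). exp (- 2 * J e)))
      = 2 * (\<Sum>P\<in>polygon_configs_in_class G p B \<epsilon>. \<Prod>e\<in>P. exp (- 2 * J e))"
    using sum_over_face_sets[OF D] class_D by simp
  finally show ?thesis by (simp add: D_def)
qed

end
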